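(* Let $(x_n)_{n\ge0}$ be the $\mathbb R^d$-valued iterates $x_{n+1}=x_n+a(n)[h(x_n)+M_{n+1}]$, let $V$, $H$ be as in the context, and let $B$ be a bounded open set with $H\subset B$. Assume: (A1) $h:\mathbb R^d\to\mathbb R^d$ is Lipschitz; (A2) $a(n)>0$, $\sum_n a(n)=\infty$, $\sum_n a(n)^2<\infty$, and there is $c>0$ such that $a(n)\le c\,a(m)$ for all $n\ge m$; (A3) $(M_n)_{n\ge1}$ is a square integrable martingale difference sequence with respect to $\mathcal F_n=\sigma(x_0,M_1,\ldots,M_n)$, i.e. $E[M_{n+1}\mid\mathcal F_n]=0$ a.s. for all $n\ge0$, and $E[\|M_{n+1}\|^2\mid\mathcal F_n]\le c(1+\|x_n\|^2)$ a.s. for all $n\ge 0$ and some $0<c<\infty$; (tail bound) there are positive constants $C_1,C_2$ such that, for all $v$ large enough and all $i\ge0$, $$\mathbb P\left[\left.\frac{\|M_{i+1}\|}{1+\|x_i\|}>v\right|\mathcal F_i\right]\le C_1\exp(-C_2v)\quad\text{a.s.};$$ (step sizes) there is a positive constant $\gamma_T$ depending only on $T$ such that $a(n_i+m_1)/a(n_i+m_2)<\gamma_T$ whenever $n_i\le n_i+m_1,\,n_i+m_2<n_{i+1}$, for the indices $n_i$ defined in the context. Then there are positive constants $c_1,c$, not depending on $n_0$, such that, provided $n_0$ is sufficiently large, $$\mathbb P[x_n\rightarrow H\mid x_{n_0}\in B]\ \ge\ 1-c_1\exp\left(-\frac{c\,\delta^{2/3}}{\sqrt[4]{b(n_0)}}\right),$$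 where $b(n_0)=\sum_{m=n_0}^\infty a(m)^2$ and $\delta=\delta_B/2K_T$, with $\delta_B,K_T$ as in the context.
   Context: $V:\mathbb R^d\to[0,\infty)$ is differentiable with $\lim_{\|x\|\uparrow\infty}V(x)=\infty$ and $\nabla V(x)\cdot h(x)\le 0$ for all $x$. $H:=\{x:\nabla V(x)\cdot h(x)=0\}$ is assumed to coincide with $\{x:V(x)=0\}$ (so $H$ is compact). $x_n\to H$ means that the distance from $x_n$ to $H$ tends to $0$. Fix $T\in(0,\infty)$. Let $t(n)=\sum_{i=0}^{n-1}a(i)$. For $n_0\ge0$ define $n_i=\min\{n:t(n)\ge t(n_{i-1})+T\}$, $i\ge1$. Let $\bar x(\cdot)$ be given by $\bar x(t(n))=x_n$ with linear interpolation on each $[t(n),t(n+1)]$. Let $x^{t(n_i)}(\cdot)$ be the solution on $[t(n_i),t(n_{i+1}))$ of $\dot x(t)=h(x(t))$ with $x^{t(n_i)}(t(n_i))=x_{n_i}$, and let $\rho_i:=\sup_{t\in[t(n_i),t(n_{i+1}))}\|\bar x(t)-x^{t(n_i)}(t)\|$. $\delta_B>0$ is a constant (not depending on $i$ or $n_0$) such that if $x_{n_i}\in B$ and $\rho_i<\delta_B$ then $x_{n_{i+1}}\in B$. For $i\ge0$, $\mathcal B_i$ is the event that $x_{n_0}\in B$ and $\rho_k<\delta_B$ for $k=0,\ldots,i$; $\mathcal B_{-1}$ is the event $x_{n_0}\in B$. $K_T>0$ is a constant depending only on $T$ such that, with $\delta=\delta_B/2K_T$, for all $n_0$ sufficiently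 large and all $i\ge0$, $$\mathbb P[\rho_i\ge\delta_B\mid\mathcal B_{i-1}]\le\mathbb P\Big[\max_{0\le j<n_{i+1}-n_i}\Big\|\sum_{m=0}^{j}a(n_i+m)M_{n_i+m+1}\Big\|>\delta\ \Big|\ \mathcal B_{i-1}\Big].$$ (The existence of such $\delta_B$ and $K_T$ is recalled from earlier literature and is part of the setting.) Conditional probabilities given an event are considered when that event has positive probability. *)

theory Defs
  imports "HOL-Probability.Probability"
begin

definition sa_time :: "(nat \<Rightarrow> real) \<Rightarrow> nat \<Rightarrow> real" where
  "sa_time a n = (\<Sum>i<n. a i)"

primrec sa_index :: "(nat \<Rightarrow> real) \<Rightarrow> real \<Rightarrow> nat \<Rightarrow> nat \<Rightarrow> nat" where
  "sa_index a T n0 0 = n0"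
| "sa_index a T n0 (Suc i) = (LEAST n. sa_time a n \<ge> sa_time a (sa_index a T n0 i) + T)"

definition sa_interp :: "(nat \<Rightarrow> real) \<Rightarrow> (nat \<Rightarrow> 'a::real_vector) \<Rightarrow> real \<Rightarrow> 'a" where
  \<comment> \<open>for \<open>t \<ge> 0\<close>, the \<open>n\<close> chosen here is the one with \<open>sa_time a n \<le> t < sa_time a (Suc n)\<close>\<close>
  "sa_interp a x t =
     (let n = (LEAST n. t < sa_time a (Suc n))
      in x n + ((t - sa_time a n) / a n) *\<^sub>R (x (Suc n) - x n))"

definition ivp_solution ::
    "('a::real_normed_vector \<Rightarrow> 'a) \<Rightarrow> real \<Rightarrow> real \<Rightarrow> 'a \<Rightarrow> (real \<Rightarrow> 'a) \<Rightarrow> bool" where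
  "ivp_solution h s u y0 y \<longleftrightarrow>
     y s = y0 \<and> (\<forall>t\<in>{s..<u}. (y has_vector_derivative h (y t)) (at t within {s..<u}))"

text \<open>
  In \<open>sa_rho\<close> and \<open>sa_good\<close>, \<open>x\<close> is one sample path and \<open>y i\<close> is the solution of the
  limiting ODE restarted from that path at time \<open>t(n\<^sub>i)\<close>.
\<close>

definition sa_rho ::
    "(nat \<Rightarrow> real) \<Rightarrow> real \<Rightarrow> nat \<Rightarrow> (nat \<Rightarrow> 'a::real_normed_vector) \<Rightarrow> (nat \<Rightarrow> real \<Rightarrow> 'a) \<Rightarrow> nat \<Rightarrow> real" where
  "sa_rho a T n0 x y i =
     (SUP t\<in>{sa_time a (sa_index a T n0 i)..<sa_time a (sa_index a T n0 (Suc i))}.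
        norm (sa_interp a x t - y i t))"

text \<open>
  The index is shifted by one so that it stays in \<open>nat\<close>: \<open>sa_good \<dots> i\<close> is membership in the
  event \<open>\<B>\<^sub>i\<^sub>-\<^sub>1\<close>, and \<open>sa_good \<dots> 0\<close> says just that the path is in \<open>B\<close> at \<open>n0\<close>.
\<close>

definition sa_good ::
    "(nat \<Rightarrow> real) \<Rightarrow> real \<Rightarrow> 'a set \<Rightarrow> real \<Rightarrow> nat \<Rightarrow> (nat \<Rightarrow> 'a::real_normed_vector) \<Rightarrow> (nat \<Rightarrow> real \<Rightarrow> 'a) \<Rightarrow> nat \<Rightarrow> bool" where
  "sa_good a T B \<delta>B n0 x y i \<longleftrightarrow> x n0 \<in> B \<and> (\<forall>k<i. sa_rho a T n0 x y k < \<delta>B)"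

definition sa_history ::
    "'w measure \<Rightarrow> ('w \<Rightarrow> 'a::topological_space) \<Rightarrow> (nat \<Rightarrow> 'w \<Rightarrow> 'a) \<Rightarrow> nat \<Rightarrow> 'w measure" where
  "sa_history P x0 M n = sigma (space P)
     ({x0 -` A \<inter> space P |A. A \<in> sets borel} \<union>
      {M k -` A \<inter> space P |k A. k \<in> {1..n} \<and> A \<in> sets borel})"

text \<open>
  The library's conditional expectation is real-valued, so the vector equation
  \<open>E[M\<^sub>n\<^sub>+\<^sub>1 | F\<^sub>n] = 0\<close> is stated coordinatewise. Nothing is required of \<open>M 0\<close>.
\<close>

definition sq_int_martingale_difference ::
    "'w measure \<Rightarrow> ('w \<Rightarrow> 'a::euclidean_space) \<Rightarrow> (nat \<Rightarrow> 'w \<Rightarrow> 'a) \<Rightarrow> bool" where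
  "sq_int_martingale_difference P x0 M \<longleftrightarrow>
     (\<forall>n. M (Suc n) \<in> borel_measurable P \<and>
          integrable P (\<lambda>\<omega>. (norm (M (Suc n) \<omega>))\<^sup>2) \<and>
          (\<forall>e\<in>Basis. AE \<omega> in P.
             real_cond_exp P (sa_history P x0 M n) (\<lambda>\<omega>. M (Suc n) \<omega> \<bullet> e) \<omega> = 0))"

end

theory Submission
  imports Defs
begin

text \<open>
  Call block \<open>i\<close> the range of indices from \<open>n\<^sub>i\<close> to \<open>n\<^sub>i\<^sub>+\<^sub>1\<close>. The proof compares the iterates with the
  ODE block by block, and shows that the noise accumulated in a block is small with overwhelming
  probability.

  \<^emph>\<open>Concentration.\<close> Within a block all steps are comparable to \<open>\<alpha> = a(n\<^sub>i)\<close> and their squares add up to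
  \<open>O(\<alpha>)\<close>. The tail bound for the noise is relative to \<open>1 + \<parallel>x\<parallel>\<close>, but while the accumulated noise stays
  below \<open>\<delta>\<close> the iterates that started in \<open>B\<close> stay in a fixed ball by Gronwall's inequality. The sum
  stopped at its first passage above \<open>\<delta>\<close> thus has subexponential increments, and an exponential
  supermartingale argument bounds the probability that it passes \<open>\<delta>\<close> by a multiple of \<open>exp (- \<kappa> / \<alpha>)\<close>,
  conditionally on the past (\<open>block_concentration\<close>). The first steps of the blocks are summable,
  with sum at most a multiple of \<open>b(n\<^sub>0)\<close>; hence these probabilities sum to at most a multiple of
  \<open>b(n\<^sub>0) exp (- c / b(n\<^sub>0))\<close> (\<open>block_exp_sum\<close>), which for \<open>b(n\<^sub>0) \<le> 1\<close> is better than the claim with its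
  fourth root. By the hypothesis on the constant \<open>K\<close> this also bounds the probability, given a start
  in \<open>B\<close>, that \<open>\<rho>\<^sub>i \<ge> \<delta>B\<close> for some \<open>i\<close>.

  \<^emph>\<open>Convergence.\<close> If \<open>\<rho>\<^sub>i < \<delta>B\<close> for all \<open>i\<close>, every block starts in \<open>B\<close>. The same concentration bound, now
  for arbitrarily small thresholds, and the Borel--Cantelli lemma make the noise per block tend to
  zero almost surely. The iterates then follow the restarted solutions with vanishing error, and
  since a solution that starts in \<open>B\<close> with \<open>V \<ge> \<epsilon>\<close> lowers \<open>V\<close> in each block by at least
  an amount that depends only on \<open>\<epsilon>\<close>
  (\<open>V_uniform_drop\<close>), \<open>V\<close> tends to zero along the iterates (\<open>path_converges\<close>). As \<open>gradV\<close> may be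
  discontinuous, the amount is found by a first-order expansion at single points and compactness.

  \<^emph>\<open>Measurability.\<close> The quantities \<open>\<rho>\<^sub>i\<close> are suprema over a continuum of times of expressions in solutions
  that are chosen outcome by outcome. They are random variables because solutions depend on
  their starting points in a Lipschitz way (\<open>sa_rho_measurable\<close>), and then the events \<open>\<B>\<^sub>i\<close> belong to
  the \<open>\<sigma>\<close>-algebras on which the concentration bound conditions.
\<close>

section \<open>A discrete Gronwall inequality and blocks of step sizes\<close>

text \<open>
  Induction on the right-hand side of the hypothesis rather than on \<open>u\<close> itself:
  each step multiplies it by at most \<open>1 + b j \<le> exp (b j)\<close>.
\<close>

lemma discrete_gronwall:
  fixes u b :: "nat \<Rightarrow> real"
  assumes b: "\<And>m. b m \<ge> 0" and c: "c \<ge> 0"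
    and u: "\<And>j. j \<le> N \<Longrightarrow> u j \<le> c + (\<Sum>m<j. b m * u m)"
    and j: "j \<le> N"
  shows "u j \<le> c * exp (\<Sum>m<j. b m)"
proof -
  have sum_le: "c + (\<Sum>m<j. b m * u m) \<le> c * exp (\<Sum>m<j. b m)" if "j \<le> N" for j
    using that
  proof (induction j)
    case 0
    then show ?case by simp
  next
    case (Suc j)
    have IH: "c + (\<Sum>m<j. b m * u m) \<le> c * exp (\<Sum>m<j. b m)" using Suc by simp
    have "u j \<le> c * exp (\<Sum>m<j. b m)" using u[of j] IH Suc.prems by simp
    then have "b j * u j \<le> b j * (c * exp (\<Sum>m<j. b m))"
      by (intro mult_left_mono b)
    then have "c + (\<Sum>m<Suc j. b m * u m) \<le> c * exp (\<Sum>m<j. b m) * (1 + b j)"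
      using IH by (simp add: algebra_simps)
    also have "\<dots> \<le> c * exp (\<Sum>m<j. b m) * exp (b j)"
      by (intro mult_left_mono) (auto simp: c)
    also have "\<dots> = c * exp (\<Sum>m<Suc j. b m)" by (simp add: exp_add)
    finally show ?case .
  qed
  show ?thesis using u[OF j] sum_le[OF j] by linarith
qed

locale step_blocks =
  fixes a :: "nat \<Rightarrow> real" and T \<gamma> :: real
  assumes a_pos: "\<And>n. a n > 0"
    and a_not_summable: "\<not> summable a"
    and a_sq_summable: "summable (\<lambda>n. (a n)\<^sup>2)"
    and T_pos: "T > 0"
    and \<gamma>_pos: "\<gamma> > 0"
    and a_ratio: "\<And>n0 i m1 m2.
          sa_index a T n0 i + m1 < sa_index a T n0 (Suc i) \<Longrightarrow>
          sa_index a T n0 i + m2 < sa_index a T n0 (Suc i) \<Longrightarrow>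
          a (sa_index a T n0 i + m1) / a (sa_index a T n0 i + m2) < \<gamma>"
begin

abbreviation idx :: "nat \<Rightarrow> nat \<Rightarrow> nat" where "idx \<equiv> sa_index a T"
abbreviation tm :: "nat \<Rightarrow> real" where "tm \<equiv> sa_time a"

text \<open>
  A uniform bound on the duration of a block: a block overshoots \<open>T\<close> by less than its last step,
  and every step is at most the \<open>\<ell>\<^sup>2\<close> norm of the step sizes.
\<close>

definition horizon :: real where "horizon = T + sqrt (\<Sum>n. (a n)\<^sup>2)"

lemma a_nonneg: "a n \<ge> 0"
  using a_pos[of n] by simp

lemma tm_add: "tm (n + j) = tm n + (\<Sum>m<j. a (n + m))"
  by (induction j) (auto simp: sa_time_def)

lemma tm_Suc: "tm (Suc n) = tm n + a n"
  by (simp add: sa_time_def)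

lemma strict_mono_tm: "strict_mono tm"
  by (rule strict_monoI_Suc) (simp add: tm_Suc a_pos)

lemma tm_le_iff: "tm m \<le> tm n \<longleftrightarrow> m \<le> n"
  using strict_mono_tm by (simp add: strict_mono_less_eq)

lemma tm_less_iff: "tm m < tm n \<longleftrightarrow> m < n"
  using strict_mono_tm by (simp add: strict_mono_less)

lemma tm_unbounded: "\<exists>n. tm n \<ge> c"
proof (rule ccontr)
  assume "\<nexists>n. tm n \<ge> c"
  then have "(\<Sum>i<n. a i) \<le> c" for n by (auto simp: sa_time_def not_le intro: less_imp_le)
  then have "summable a"
    by (intro summableI_nonneg_bounded[where x = c]) (auto simp: a_nonneg)
  then show False using a_not_summable by simp
qed

lemma tm_idx_Suc_ge: "tm (idx n0 (Suc i)) \<ge> tm (idx n0 i) + T"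
  unfolding sa_index.simps using tm_unbounded by (rule LeastI_ex)

lemma tm_before_idx_Suc: "m < idx n0 (Suc i) \<Longrightarrow> tm m < tm (idx n0 i) + T"
  unfolding sa_index.simps using not_less_Least by fastforce

lemma idx_less_Suc: "idx n0 i < idx n0 (Suc i)"
  using tm_idx_Suc_ge[of n0 i] T_pos by (simp add: tm_less_iff[symmetric] del: sa_index.simps)

declare sa_index.simps(2) [simp del]

lemma strict_mono_idx: "strict_mono (idx n0)"
  by (rule strict_monoI_Suc) (rule idx_less_Suc)

lemma idx_mono: "i \<le> j \<Longrightarrow> idx n0 i \<le> idx n0 j"
  using strict_mono_idx by (simp add: strict_mono_less_eq)

lemma n0_le_idx: "n0 \<le> idx n0 i"
  using idx_mono[of 0 i n0] by simp

lemma a_le_max: "a n \<le> sqrt (\<Sum>n. (a n)\<^sup>2)"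
proof -
  have "(a n)\<^sup>2 \<le> (\<Sum>n. (a n)\<^sup>2)"
    using sum_le_suminf[OF a_sq_summable, of "{n}"] by simp
  then show ?thesis by (rule real_le_rsqrt)
qed

lemma horizon_pos: "horizon > 0"
  using T_pos a_pos[of 0] a_le_max[of 0] by (simp add: horizon_def)

lemma tm_idx_Suc_le: "tm (idx n0 (Suc i)) \<le> tm (idx n0 i) + horizon"
proof -
  obtain m where m: "idx n0 (Suc i) = Suc m"
    using idx_less_Suc[of n0 i] by (cases "idx n0 (Suc i)") auto
  show ?thesis
    using tm_before_idx_Suc[of m n0 i] a_le_max[of m] by (simp add: m tm_Suc horizon_def)
qed

lemma block_time_le:
  assumes "idx n0 i + j \<le> idx n0 (Suc i)"
  shows "(\<Sum>m<j. a (idx n0 i + m)) \<le> horizon"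
proof -
  have "tm (idx n0 i + j) \<le> tm (idx n0 (Suc i))" using assms by (simp add: tm_le_iff)
  then show ?thesis using tm_idx_Suc_le[of n0 i] by (simp add: tm_add)
qed

lemma block_step_le:
  assumes "idx n0 i + m < idx n0 (Suc i)"
  shows "a (idx n0 i + m) \<le> \<gamma> * a (idx n0 i)" "a (idx n0 i) \<le> \<gamma> * a (idx n0 i + m)"
  using a_ratio[of n0 i m 0] a_ratio[of n0 i 0 m] assms idx_less_Suc[of n0 i] a_pos
  by (auto simp: field_simps)

lemma a_tendsto_0: "a \<longlonglongrightarrow> 0"
proof -
  have "(\<lambda>n. sqrt ((a n)\<^sup>2)) \<longlonglongrightarrow> sqrt 0"
    by (intro tendsto_real_sqrt summable_LIMSEQ_zero a_sq_summable)
  then show ?thesis by (simp add: a_nonneg)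
qed

lemma idx_tendsto: "filterlim (idx n0) sequentially sequentially"
  by (rule filterlim_subseq[OF strict_mono_idx])

lemma a_idx_tendsto_0: "(\<lambda>i. a (idx n0 i)) \<longlonglongrightarrow> 0"
  by (rule filterlim_compose[OF a_tendsto_0 idx_tendsto])

definition tail_sq :: "nat \<Rightarrow> real" where "tail_sq n = (\<Sum>m. (a (n + m))\<^sup>2)"

lemma shifted_sq_summable: "summable (\<lambda>m. (a (n + m))\<^sup>2)"
  using summable_ignore_initial_segment[OF a_sq_summable, of n] by (simp add: add.commute)

lemma tail_sq_pos: "tail_sq n > 0"
  unfolding tail_sq_def
  by (rule suminf_pos[OF shifted_sq_summable]) (use a_pos in \<open>simp add: less_le\<close>)

lemma tail_sq_tendsto_0: "tail_sq \<longlonglongrightarrow> 0"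
  using suminf_exist_split2[OF a_sq_summable]
  by (simp add: tail_sq_def[abs_def] add.commute)

text \<open>
  A block lasts at least \<open>T\<close> and its steps are comparable to its first one, so its sum of squared
  steps controls the first step. Together with the disjointness of the blocks this makes the tail
  of the squared step sizes a bound for the sum of the first steps of all blocks.
\<close>

lemma first_step_le_block_sq:
  "T / \<gamma> * a (idx n0 i) \<le> (\<Sum>k\<in>{idx n0 i..<idx n0 (Suc i)}. (a k)\<^sup>2)"
proof -
  let ?I = "{idx n0 i..<idx n0 (Suc i)}"
  have "(\<Sum>k\<in>?I. a k) = tm (idx n0 (Suc i)) - tm (idx n0 i)"
    using sum_diff_nat_ivl[of 0 "idx n0 i" "idx n0 (Suc i)" a] idx_less_Suc[of n0 i]
    by (simp add: sa_time_def atLeast0LessThan)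
  then have T: "T \<le> (\<Sum>k\<in>?I. a k)" using tm_idx_Suc_ge[of n0 i] by simp
  have "T / \<gamma> * a (idx n0 i) \<le> (\<Sum>k\<in>?I. a k) * (a (idx n0 i) / \<gamma>)"
    using mult_right_mono[OF T, of "a (idx n0 i) / \<gamma>"] a_nonneg \<gamma>_pos by (simp add: field_simps)
  also have "\<dots> = (\<Sum>k\<in>?I. a k * (a (idx n0 i) / \<gamma>))" by (simp add: sum_distrib_right sum_divide_distrib)
  also have "\<dots> \<le> (\<Sum>k\<in>?I. (a k)\<^sup>2)"
  proof (rule sum_mono)
    fix k assume k: "k \<in> ?I"
    then have "a (idx n0 i) \<le> \<gamma> * a k"
      using block_step_le(2)[of n0 i "k - idx n0 i"] by simp
    then have "a (idx n0 i) / \<gamma> \<le> a k" using \<gamma>_pos by (simp add: field_simps)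
    then show "a k * (a (idx n0 i) / \<gamma>) \<le> (a k)\<^sup>2"
      unfolding power2_eq_square by (intro mult_left_mono a_nonneg)
  qed
  finally show ?thesis .
qed

lemma sum_first_steps_le: "(\<Sum>i<n. a (idx n0 i)) \<le> \<gamma> / T * tail_sq n0"
proof -
  have blocks: "(\<Sum>i<n. \<Sum>k\<in>{idx n0 i..<idx n0 (Suc i)}. (a k)\<^sup>2) = (\<Sum>k\<in>{n0..<idx n0 n}. (a k)\<^sup>2)"
  proof (induction n)
    case (Suc n)
    show ?case
      using sum.atLeastLessThan_concat[of n0 "idx n0 n" "idx n0 (Suc n)" "\<lambda>k. (a k)\<^sup>2"]
        n0_le_idx[of n0 n] idx_less_Suc[of n0 n] Suc by simp
  qed simp
  have shift: "(\<Sum>k\<in>{n0..<n0 + m}. (a k)\<^sup>2) = (\<Sum>k<m. (a (n0 + k))\<^sup>2)" for m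
    by (induction m) auto
  have "(\<Sum>k\<in>{n0..<idx n0 n}. (a k)\<^sup>2) = (\<Sum>k<idx n0 n - n0. (a (n0 + k))\<^sup>2)"
    using shift[of "idx n0 n - n0"] n0_le_idx[of n0 n] by simp
  also have "\<dots> \<le> tail_sq n0"
    unfolding tail_sq_def by (rule sum_le_suminf[OF shifted_sq_summable]) auto
  finally have "(\<Sum>i<n. T / \<gamma> * a (idx n0 i)) \<le> tail_sq n0"
    unfolding blocks[symmetric] by (rule order_trans[OF sum_mono[OF first_step_le_block_sq]])
  then have "T / \<gamma> * (\<Sum>i<n. a (idx n0 i)) \<le> tail_sq n0" by (simp add: sum_distrib_left)
  then show ?thesis using T_pos \<gamma>_pos by (simp add: field_simps)
qed

text \<open>
  The exponent is split into two halves. One half makes the sum over the blocks converge, through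
  \<open>exp (- z) \<le> 1 / z\<close> and the summability of the first steps; the other half is bounded uniformly in
  the block, since every first step is at most a multiple of the tail of the squared steps.
\<close>

lemma block_exp_sum:
  assumes \<kappa>: "\<kappa> > 0"
  shows "(\<Sum>i<n. exp (- \<kappa> / a (idx n0 i)))
           \<le> 2 * \<gamma> / (\<kappa> * T) * tail_sq n0 * exp (- (\<kappa> * T / (2 * \<gamma>)) / tail_sq n0)"
proof -
  let ?E = "exp (- (\<kappa> * T / (2 * \<gamma>)) / tail_sq n0)"
  have bound: "exp (- \<kappa> / a (idx n0 i)) \<le> a (idx n0 i) * (2 / \<kappa> * ?E)" for i
  proof -
    let ?\<alpha> = "a (idx n0 i)"
    have \<alpha>: "?\<alpha> > 0" by (rule a_pos)
    have "?\<alpha> \<le> (\<Sum>i<Suc i. a (idx n0 i))"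
      by (rule member_le_sum) (auto simp: a_nonneg)
    also have "\<dots> \<le> \<gamma> / T * tail_sq n0" by (rule sum_first_steps_le)
    finally have le: "?\<alpha> \<le> \<gamma> / T * tail_sq n0" .
    have "\<kappa> * T / (2 * \<gamma>) / tail_sq n0 \<le> \<kappa> / (2 * ?\<alpha>)"
      using le \<alpha> \<kappa> T_pos \<gamma>_pos tail_sq_pos[of n0] by (simp add: field_simps)
    then have E: "exp (- (\<kappa> / (2 * ?\<alpha>))) \<le> ?E" by simp
    have "\<kappa> / (2 * ?\<alpha>) \<le> exp (\<kappa> / (2 * ?\<alpha>))"
      using exp_ge_add_one_self[of "\<kappa> / (2 * ?\<alpha>)"] by linarith
    then have "exp (- (\<kappa> / (2 * ?\<alpha>))) \<le> 2 * ?\<alpha> / \<kappa>"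
      using \<kappa> \<alpha> by (simp add: exp_minus field_simps)
    then have "exp (- (\<kappa> / (2 * ?\<alpha>))) * exp (- (\<kappa> / (2 * ?\<alpha>))) \<le> (2 * ?\<alpha> / \<kappa>) * ?E"
      using E \<kappa> \<alpha> by (intro mult_mono) auto
    moreover have "exp (- (\<kappa> / (2 * ?\<alpha>))) * exp (- (\<kappa> / (2 * ?\<alpha>))) = exp (- \<kappa> / ?\<alpha>)"
      by (simp add: exp_add[symmetric])
    ultimately show ?thesis by (simp add: mult_ac)
  qed
  have "(\<Sum>i<n. exp (- \<kappa> / a (idx n0 i))) \<le> (\<Sum>i<n. a (idx n0 i)) * (2 / \<kappa> * ?E)"
    unfolding sum_distrib_right by (rule sum_mono) (rule bound)
  also have "\<dots> \<le> \<gamma> / T * tail_sq n0 * (2 / \<kappa> * ?E)"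
    by (intro mult_right_mono sum_first_steps_le) (use \<kappa> in auto)
  finally show ?thesis by (simp add: field_simps)
qed

end

section \<open>Solutions of the limiting ODE and the Lyapunov function\<close>

lemma nonincreasing_if_derivative_nonpos_within:
  fixes f f' :: "real \<Rightarrow> real"
  assumes st: "s \<le> t1" "t1 \<le> t2" "t2 < u"
    and der: "\<And>t. t \<in> {s..<u} \<Longrightarrow> (f has_field_derivative f' t) (at t within {s..<u})"
    and neg: "\<And>t. t \<in> {s..<u} \<Longrightarrow> f' t \<le> 0"
  shows "f t2 \<le> f t1"
proof (rule DERIV_nonpos_imp_decreasing_open[OF st(2)])
  show "continuous_on {t1..t2} f"
    by (rule continuous_on_subset[where s = "{s..<u}"], rule DERIV_continuous_on[OF der])
      (use st in auto)
  fix t assume t: "t1 < t" "t < t2"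
  have "t \<in> interior {s..<u}" using st t by simp
  then have "at t within {s..<u} = at t" by (rule at_within_interior)
  then show "\<exists>y. (f has_real_derivative y) (at t) \<and> y \<le> 0"
    using der[of t] neg[of t] st t by auto
qed

lemma ivp_solution_start: "ivp_solution h s u y0 y \<Longrightarrow> y s = y0"
  by (simp add: ivp_solution_def)

lemma ivp_solution_deriv:
  "ivp_solution h s u y0 y \<Longrightarrow> t \<in> {s..<u} \<Longrightarrow>
     (y has_vector_derivative h (y t)) (at t within {s..<u})"
  by (simp add: ivp_solution_def)

text \<open>
  Gronwall's estimate in differential form: the Lipschitz bound makes the function
  \<open>\<parallel>y t - z t\<parallel>\<^sup>2 exp (- 2 L (t - s))\<close> nonincreasing. It yields the uniqueness of solutions, and also
  that they depend on the starting point in a Lipschitz way, which is what measurability needs.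
\<close>

lemma ivp_solution_dist_le:
  fixes h :: "'a::euclidean_space \<Rightarrow> 'a"
  assumes L: "L-lipschitz_on UNIV h"
    and y: "ivp_solution h s u y0 y" and z: "ivp_solution h s u z0 z"
    and t: "t \<in> {s..<u}"
  shows "norm (y t - z t) \<le> exp (L * (t - s)) * norm (y0 - z0)"
proof -
  let ?d = "\<lambda>t. y t - z t"
  let ?g = "\<lambda>t. (?d t \<bullet> ?d t) * exp (- 2 * L * (t - s))"
  let ?g' = "\<lambda>t. (2 * (?d t \<bullet> (h (y t) - h (z t))) - 2 * L * (?d t \<bullet> ?d t)) * exp (- 2 * L * (t - s))"
  have der: "(?g has_field_derivative ?g' t) (at t within {s..<u})" if "t \<in> {s..<u}" for t
  proof -
    have d: "(?d has_vector_derivative (h (y t) - h (z t))) (at t within {s..<u})"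
      by (intro derivative_intros ivp_solution_deriv[OF y that] ivp_solution_deriv[OF z that])
    have "((\<lambda>t. ?d t \<bullet> ?d t) has_field_derivative 2 * (?d t \<bullet> (h (y t) - h (z t)))) (at t within {s..<u})"
      using has_derivative_inner[OF d[unfolded has_vector_derivative_def] d[unfolded has_vector_derivative_def]]
      unfolding has_field_derivative_def
      by (rule has_derivative_eq_rhs) (simp add: inner_commute fun_eq_iff)
    moreover have "((\<lambda>t. exp (- 2 * L * (t - s))) has_field_derivative - 2 * L * exp (- 2 * L * (t - s)))
        (at t within {s..<u})"
      by (auto intro!: derivative_eq_intros)
    ultimately show ?thesis
      by (rule DERIV_cong[OF DERIV_mult]) (simp only: algebra_simps)
  qed
  have neg: "?g' t \<le> 0" for t
  proof -
    have "?d t \<bullet> (h (y t) - h (z t)) \<le> norm (?d t) * norm (h (y t) - h (z t))"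
      by (rule norm_cauchy_schwarz)
    also have "\<dots> \<le> norm (?d t) * (L * norm (?d t))"
      using lipschitz_onD[OF L, of "y t" "z t"] by (intro mult_left_mono) (auto simp: dist_norm)
    also have "\<dots> = L * (?d t \<bullet> ?d t)" by (simp add: dot_square_norm power2_eq_square)
    finally show ?thesis by (intro mult_nonpos_nonneg) auto
  qed
  have "?g t \<le> ?g s"
    by (rule nonincreasing_if_derivative_nonpos_within[where s = s and u = u, OF _ _ _ der neg]) (use t in auto)
  also have "?g s = (norm (y0 - z0))\<^sup>2"
    using ivp_solution_start[OF y] ivp_solution_start[OF z] by (simp add: dot_square_norm)
  finally have "(norm (?d t))\<^sup>2 * exp (- 2 * L * (t - s)) \<le> (norm (y0 - z0))\<^sup>2"
    by (simp add: dot_square_norm)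
  then have "(norm (?d t))\<^sup>2 * exp (- 2 * L * (t - s)) * exp (2 * L * (t - s))
      \<le> (norm (y0 - z0))\<^sup>2 * exp (2 * L * (t - s))"
    by (rule mult_right_mono) simp
  then have "(norm (?d t))\<^sup>2 \<le> (norm (y0 - z0))\<^sup>2 * exp (2 * L * (t - s))"
    by (simp add: exp_add[symmetric] mult.assoc)
  also have "\<dots> = (exp (L * (t - s)) * norm (y0 - z0))\<^sup>2"
    by (simp add: power_mult_distrib exp_double[symmetric] mult_ac)
  finally show ?thesis by (rule power2_le_imp_le) simp
qed

text \<open>
  On the interval the velocity changes by at most \<open>L C (t2 - t1)\<close>, because the solution itself moves
  by at most \<open>C (t2 - t1)\<close>; the mean value inequality does the rest.
\<close>

lemma ivp_solution_euler_step:
  fixes h :: "'a::euclidean_space \<Rightarrow> 'a"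
  assumes L: "L-lipschitz_on UNIV h"
    and y: "ivp_solution h s u y0 y"
    and C: "\<And>t. t \<in> {s..<u} \<Longrightarrow> norm (h (y t)) \<le> C"
    and t: "s \<le> t1" "t1 \<le> t2" "t2 < u"
  shows "norm (y t2 - y t1 - (t2 - t1) *\<^sub>R h (y t1)) \<le> L * C * (t2 - t1)\<^sup>2"
proof -
  have der: "(y has_vector_derivative h (y t)) (at t within {t1..t2})" if "t \<in> {t1..t2}" for t
    by (rule has_vector_derivative_within_subset[OF ivp_solution_deriv[OF y]]) (use t that in auto)
  have "L \<ge> 0" using L by (rule lipschitz_on_nonneg)
  have near: "norm (y t - y t1) \<le> C * (t2 - t1)" if "t \<in> {t1..t2}" for t
  proof -
    have "norm (y t - y t1) \<le> C * norm (t - t1)"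
    proof (rule differentiable_bound[of "{t1..t2}" y "\<lambda>t v. v *\<^sub>R h (y t)"])
      show "(y has_derivative (\<lambda>v. v *\<^sub>R h (y r))) (at r within {t1..t2})" if "r \<in> {t1..t2}" for r
        using der[OF that] by (simp add: has_vector_derivative_def)
      show "onorm (\<lambda>v. v *\<^sub>R h (y r)) \<le> C" if "r \<in> {t1..t2}" for r
        by (rule onorm_le) (use C[of r] t that in \<open>auto simp: mult.commute[of C] intro!: mult_left_mono\<close>)
    qed (use that t in auto)
    also have "\<dots> \<le> C * (t2 - t1)"
    proof (rule mult_left_mono)
      show "C \<ge> 0" using C[of s] t norm_ge_zero[of "h (y s)"] by (meson atLeastLessThan_iff le_less_trans order_trans order_refl)
    qed (use that in auto)
    finally show ?thesis .
  qed
  have "norm (y t2 - y t1 - (t2 - t1) *\<^sub>R h (y t1)) \<le> norm (t2 - t1) * (L * (C * (t2 - t1)))"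
  proof (rule vector_differentiable_bound_linearization[OF der])
    fix t assume "t \<in> {t1..t2}"
    have "norm (h (y t) - h (y t1)) \<le> L * norm (y t - y t1)"
      using lipschitz_onD[OF L, of "y t" "y t1"] by (simp add: dist_norm)
    also have "\<dots> \<le> L * (C * (t2 - t1))"
      by (intro mult_left_mono near) (use \<open>t \<in> {t1..t2}\<close> \<open>L \<ge> 0\<close> in auto)
    finally show "norm (h (y t) - h (y t1)) \<le> L * (C * (t2 - t1))" .
  qed (use t in \<open>auto simp: closed_segment_eq_real_ivl\<close>)
  then show ?thesis using t by (simp add: power2_eq_square mult_ac)
qed

locale lyapunov_ode =
  fixes h gradV :: "'a::euclidean_space \<Rightarrow> 'a" and V :: "'a \<Rightarrow> real" and L :: real
  assumes h_lipschitz: "L-lipschitz_on UNIV h"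
    and V_nonneg: "\<And>y. V y \<ge> 0"
    and V_grad: "\<And>y. GDERIV V y :> gradV y"
    and V_coercive: "filterlim V at_top at_infinity"
    and V_decrease: "\<And>y. gradV y \<bullet> h y \<le> 0"
    and V_pos_decrease: "\<And>y. V y \<noteq> 0 \<Longrightarrow> gradV y \<bullet> h y \<noteq> 0"
begin

lemma L_nonneg: "L \<ge> 0"
  using h_lipschitz by (rule lipschitz_on_nonneg)

lemma h_diff_le: "norm (h y - h z) \<le> L * norm (y - z)"
  using lipschitz_onD[OF h_lipschitz, of y z] by (simp add: dist_norm)

lemma h_growth: "norm (h y) \<le> norm (h 0) + L * norm y"
  using h_diff_le[of y 0] norm_triangle_ineq2[of "h y" "h 0"] by simp

lemma V_continuous_on: "continuous_on S V"
  using V_grad unfolding gderiv_def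
  by (intro continuous_at_imp_continuous_on ballI has_derivative_continuous) auto

lemma V_antimono:
  assumes y: "ivp_solution h s u y0 y" and t: "s \<le> t1" "t1 \<le> t2" "t2 < u"
  shows "V (y t2) \<le> V (y t1)"
proof (rule nonincreasing_if_derivative_nonpos_within[where s = s and u = u, OF t])
  fix t assume "t \<in> {s..<u}"
  then have y': "(y has_derivative (\<lambda>v. v *\<^sub>R h (y t))) (at t within {s..<u})"
    using ivp_solution_deriv[OF y] by (simp add: has_vector_derivative_def)
  have "(V has_derivative (\<lambda>w. w \<bullet> gradV (y t))) (at (y t))"
    using V_grad by (simp add: gderiv_def)
  from has_derivative_compose[OF y' this]
  show "((\<lambda>t. V (y t)) has_field_derivative gradV (y t) \<bullet> h (y t)) (at t within {s..<u})"
    unfolding has_field_derivative_def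
    by (rule has_derivative_eq_rhs) (simp add: fun_eq_iff inner_commute)
qed (rule V_decrease)

lemma sublevel_bounded: "\<exists>R>0. \<forall>y. V y \<le> c \<longrightarrow> norm y \<le> R"
proof -
  have "eventually (\<lambda>y. V y > c) at_infinity"
    using V_coercive by (simp add: filterlim_at_top_dense)
  then obtain R where R: "\<And>y. norm y \<ge> R \<Longrightarrow> V y > c" by (auto simp: eventually_at_infinity)
  show ?thesis
  proof (intro exI[of _ "max R 1"] conjI allI impI)
    fix y assume "V y \<le> c"
    then have "\<not> norm y \<ge> R" using R[of y] by linarith
    then show "norm y \<le> max R 1" by linarith
  qed simp
qed

text \<open>
  The gradient of \<open>V\<close> may be discontinuous, so the rate of decrease \<open>gradV y \<bullet> h y\<close> need not stay
  away from zero near a point \<open>z\<close> where it is negative. The first-order expansion of \<open>V\<close> at the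
  single point \<open>z\<close> is enough: a solution that starts close to \<open>z\<close> is, after a short time \<open>\<tau>\<close>, within
  a small multiple of \<open>\<tau>\<close> of \<open>z + \<tau> h z\<close>, where \<open>V\<close> has dropped by nearly \<open>\<kappa> \<tau>\<close>; afterwards \<open>V\<close> cannot
  rise again.
\<close>

lemma V_local_drop:
  assumes z: "V z \<noteq> 0" and \<tau>0: "\<tau>0 > 0"
  shows "\<exists>\<eta>>0. \<exists>r>0. \<forall>y0 y s u t. dist y0 z < r \<longrightarrow> ivp_solution h s u y0 y \<longrightarrow>
           s + \<tau>0 \<le> t \<longrightarrow> t < u \<longrightarrow> V (y t) \<le> V y0 - \<eta>"
proof -
  define \<kappa> where "\<kappa> = - (gradV z \<bullet> h z)"
  have \<kappa>: "\<kappa> > 0" using V_pos_decrease[OF z] V_decrease[of z] by (simp add: \<kappa>_def)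
  define G where "G = norm (h z) + 1"
  obtain R where R: "R > 0" "\<And>y. V y \<le> V z + 1 \<Longrightarrow> norm y \<le> R"
    using sublevel_bounded by blast
  define C where "C = norm (h 0) + L * R"
  have C: "C \<ge> 0" using L_nonneg R by (simp add: C_def)
  have der: "(V has_derivative (\<lambda>w. w \<bullet> gradV z)) (at z)"
    using V_grad by (simp add: gderiv_def)
  define e where "e = \<kappa> / (8 * G)"
  have e: "e > 0" using \<kappa> by (simp add: e_def G_def add_nonneg_pos)
  obtain d where d: "d > 0" "\<And>w. norm (w - z) < d \<Longrightarrow>
      norm (V w - V z - (w - z) \<bullet> gradV z) \<le> e * norm (w - z)"
    using der e unfolding has_derivative_at_alt by blast
  define g where "g = norm (gradV z) + 1"
  have g: "g > 0" "G > 0" by (simp_all add: g_def G_def add_nonneg_pos)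
  \<comment> \<open>so short that the quadratic Euler error is negligible against \<open>\<kappa> \<tau>\<close> and the solution stays\<close>
  \<comment> \<open>in the ball of radius \<open>d\<close> in which the expansion of \<open>V\<close> at \<open>z\<close> is accurate\<close>
  define \<tau> where "\<tau> = min \<tau>0 (min (d / (4 * G)) (min (\<kappa> / (8 * g * (L * C + 1))) (1 / (L * C + 1))))"
  have LC: "L * C + 1 > 0" using L_nonneg C by (simp add: add_nonneg_pos)
  have \<tau>: "\<tau> > 0" using \<tau>0 d g \<kappa> LC by (simp add: \<tau>_def)
  have \<tau>1: "\<tau> \<le> \<tau>0" "\<tau> * G \<le> d / 4" "L * C * \<tau> * g \<le> \<kappa> / 8" "L * C * \<tau> \<le> 1"
  proof -
    show "\<tau> \<le> \<tau>0" by (simp add: \<tau>_def)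
    have "\<tau> \<le> d / (4 * G)" by (simp add: \<tau>_def)
    then show "\<tau> * G \<le> d / 4" using g by (simp add: field_simps)
    have "\<tau> \<le> \<kappa> / (8 * g * (L * C + 1))" by (simp add: \<tau>_def)
    moreover have "8 * g * (L * C + 1) > 0" using g LC by simp
    ultimately have "\<tau> * (8 * g * (L * C + 1)) \<le> \<kappa>" by (simp only: pos_le_divide_eq)
    then have "(L * C + 1) * \<tau> * g \<le> \<kappa> / 8" by (simp add: algebra_simps)
    moreover have "L * C * \<tau> * g \<le> (L * C + 1) * \<tau> * g"
      using \<tau> g by (intro mult_right_mono) auto
    ultimately show "L * C * \<tau> * g \<le> \<kappa> / 8" by linarith
    have "\<tau> \<le> 1 / (L * C + 1)" by (simp add: \<tau>_def)
    then have "\<tau> * (L * C + 1) \<le> 1" using LC by (simp only: pos_le_divide_eq)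
    then show "L * C * \<tau> \<le> 1" using \<tau> by (simp add: algebra_simps)
  qed
  have "isCont V z" using V_continuous_on[of UNIV] by (simp add: continuous_on_eq_continuous_at)
  moreover have "min 1 (\<kappa> * \<tau> / 4) > 0" using \<kappa> \<tau> by simp
  ultimately obtain r1 where r1: "r1 > 0" "\<And>y0. dist y0 z < r1 \<Longrightarrow> dist (V y0) (V z) < min 1 (\<kappa> * \<tau> / 4)"
    unfolding continuous_at_eps_delta by meson
  define q where "q = min (d / 4) (min (\<kappa> * \<tau> / (8 * g)) (\<tau> * G))"
  define r where "r = min r1 (q / (1 + \<tau> * L))"
  have q: "q > 0" using d \<kappa> \<tau> g by (simp add: q_def)
  have tL: "1 + \<tau> * L > 0" using \<tau> L_nonneg by (simp add: add_pos_nonneg)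
  have r: "r > 0" using r1 q tL by (simp add: r_def)
  show ?thesis
  proof (rule exI[of _ "\<kappa> * \<tau> / 8"], rule conjI, simp add: \<kappa> \<tau>, intro exI[of _ r] conjI r allI impI)
    fix y0 y s u t
    assume y0: "dist y0 z < r" and y: "ivp_solution h s u y0 y" and t: "s + \<tau>0 \<le> t" "t < u"
    have Vy0: "\<bar>V y0 - V z\<bar> < 1" "\<bar>V y0 - V z\<bar> < \<kappa> * \<tau> / 4"
      using r1(2)[of y0] y0 by (auto simp: r_def dist_real_def)
    have "norm (h (y t)) \<le> C" if "t \<in> {s..<u}" for t
    proof -
      have "V (y t) \<le> V (y s)" using V_antimono[OF y] that by simp
      then have "V (y t) \<le> V z + 1" using Vy0 ivp_solution_start[OF y] by simp
      then have "norm (y t) \<le> R" by (rule R(2))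
      then have "L * norm (y t) \<le> L * R" using L_nonneg by (rule mult_left_mono)
      then show ?thesis using h_growth[of "y t"] by (simp add: C_def)
    qed
    from ivp_solution_euler_step[OF h_lipschitz y this, of s "s + \<tau>"]
    have E: "norm (y (s + \<tau>) - y0 - \<tau> *\<^sub>R h y0) \<le> L * C * \<tau>\<^sup>2"
      using \<tau> \<tau>1(1) t ivp_solution_start[OF y] by simp
    define w where "w = y (s + \<tau>)"
    define err where "err = w - z - \<tau> *\<^sub>R h z"
    have "err = (w - y0 - \<tau> *\<^sub>R h y0) + (y0 - z) + \<tau> *\<^sub>R (h y0 - h z)"
      by (simp add: err_def algebra_simps)
    then have "norm err \<le> norm (w - y0 - \<tau> *\<^sub>R h y0) + norm (y0 - z) + \<tau> * norm (h y0 - h z)"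
      using norm_triangle_ineq[of "(w - y0 - \<tau> *\<^sub>R h y0) + (y0 - z)" "\<tau> *\<^sub>R (h y0 - h z)"]
        norm_triangle_ineq[of "w - y0 - \<tau> *\<^sub>R h y0" "y0 - z"] \<tau> by simp
    also have "\<dots> \<le> L * C * \<tau>\<^sup>2 + (1 + \<tau> * L) * norm (y0 - z)"
    proof -
      have "\<tau> * norm (h y0 - h z) \<le> \<tau> * (L * norm (y0 - z))"
        using \<tau> by (intro mult_left_mono h_diff_le) simp
      moreover have "(1 + \<tau> * L) * norm (y0 - z) = norm (y0 - z) + \<tau> * (L * norm (y0 - z))"
        by (simp add: algebra_simps)
      ultimately show ?thesis using E unfolding w_def by linarith
    qed
    also have "(1 + \<tau> * L) * norm (y0 - z) \<le> q"
    proof -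
      have "norm (y0 - z) \<le> q / (1 + \<tau> * L)" using y0 by (simp add: r_def dist_norm)
      then show ?thesis using tL by (simp add: field_simps)
    qed
    finally have err: "norm err \<le> L * C * \<tau>\<^sup>2 + q" by simp
    have LCt: "L * C * \<tau>\<^sup>2 \<le> \<tau>"
      using mult_right_mono[OF \<tau>1(4), of \<tau>] \<tau> by (simp add: power2_eq_square mult_ac)
    have "norm (w - z) \<le> \<tau> * norm (h z) + norm err"
      using norm_triangle_ineq[of "\<tau> *\<^sub>R h z" err] \<tau> by (simp add: err_def)
    also have "\<dots> \<le> \<tau> * G + q" using err LCt by (simp add: G_def algebra_simps)
    finally have wz: "norm (w - z) \<le> \<tau> * G + q" .
    also have "\<dots> < d" using \<tau>1(2) d by (simp add: q_def)
    finally have "norm (V w - V z - (w - z) \<bullet> gradV z) \<le> e * norm (w - z)" by (rule d(2))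
    then have 1: "V w \<le> V z + (w - z) \<bullet> gradV z + e * norm (w - z)" by (simp add: abs_le_iff)
    have "(w - z) \<bullet> gradV z = - \<kappa> * \<tau> + err \<bullet> gradV z"
    proof -
      have "w - z = \<tau> *\<^sub>R h z + err" by (simp add: err_def)
      then show ?thesis by (simp add: \<kappa>_def inner_add_left inner_commute[of "gradV z"])
    qed
    moreover have "err \<bullet> gradV z \<le> norm err * g"
      using norm_cauchy_schwarz[of err "gradV z"] norm_ge_zero[of err] 
      unfolding g_def distrib_left by linarith
    moreover have "norm err * g \<le> \<kappa> * \<tau> / 8 + \<kappa> * \<tau> / 8"
    proof -
      have "norm err * g \<le> (L * C * \<tau>\<^sup>2 + q) * g" using err g by (intro mult_right_mono) auto
      moreover have "L * C * \<tau>\<^sup>2 * g \<le> \<kappa> * \<tau> / 8"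
      proof -
        have "L * C * \<tau> * g * \<tau> \<le> \<kappa> / 8 * \<tau>" using \<tau>1(3) \<tau> by (intro mult_right_mono) auto
        then show ?thesis by (simp add: power2_eq_square mult.commute mult.left_commute)
      qed
      moreover have "q * g \<le> \<kappa> * \<tau> / 8"
      proof -
        have "q \<le> \<kappa> * \<tau> / (8 * g)" by (simp add: q_def)
        then show ?thesis using g by (simp add: field_simps)
      qed
      ultimately show ?thesis unfolding distrib_right by linarith
    qed
    moreover have "e * norm (w - z) \<le> \<kappa> * \<tau> / 8 + \<kappa> * \<tau> / 8"
    proof -
      have "e * norm (w - z) \<le> e * (\<tau> * G + q)" using wz e by (intro mult_left_mono) auto
      then have "e * norm (w - z) \<le> e * (\<tau> * G) + e * q" by (simp only: distrib_left)
      moreover have "e * (\<tau> * G) = \<kappa> * \<tau> / 8" using g by (simp add: e_def)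
      moreover have "e * q \<le> e * (\<tau> * G)" using e by (intro mult_left_mono) (simp_all add: q_def)
      ultimately show ?thesis by linarith
    qed
    ultimately have "V w \<le> V z - \<kappa> * \<tau> / 2" using 1 by linarith
    moreover have "V (y t) \<le> V w" unfolding w_def
      by (rule V_antimono[OF y]) (use \<tau> \<tau>1(1) t in auto)
    ultimately show "V (y t) \<le> V y0 - \<kappa> * \<tau> / 8" using Vy0(2) mult_pos_pos[OF \<kappa> \<tau>] by linarith
  qed
qed

text \<open>
  Finitely many of the neighbourhoods from the preceding lemma cover the compact set of starting
  points in question.
\<close>

lemma V_uniform_drop:
  assumes \<epsilon>: "\<epsilon> > 0" and \<tau>0: "\<tau>0 > 0"
  shows "\<exists>\<eta>>0. \<forall>y0 y s u t. V y0 \<ge> \<epsilon> \<longrightarrow> norm y0 \<le> R \<longrightarrow> ivp_solution h s u y0 y \<longrightarrow>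
           s + \<tau>0 \<le> t \<longrightarrow> t < u \<longrightarrow> V (y t) \<le> V y0 - \<eta>"
proof -
  define K where "K = {z. V z \<ge> \<epsilon>} \<inter> cball 0 R"
  have "compact K" unfolding K_def
    using V_continuous_on[of UNIV] by (intro closed_Int_compact closed_Collect_le) auto
  have "\<forall>z\<in>K. \<exists>\<eta>>0. \<exists>r>0. \<forall>y0 y s u t. dist y0 z < r \<longrightarrow> ivp_solution h s u y0 y \<longrightarrow>
           s + \<tau>0 \<le> t \<longrightarrow> t < u \<longrightarrow> V (y t) \<le> V y0 - \<eta>"
    using V_local_drop[OF _ \<tau>0] \<epsilon> by (auto simp: K_def)
  then obtain \<eta> r where \<eta>: "\<And>z. z \<in> K \<Longrightarrow> \<eta> z > 0" and r: "\<And>z. z \<in> K \<Longrightarrow> r z > 0"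
    and drop: "\<And>z y0 y s u t. z \<in> K \<Longrightarrow> dist y0 z < r z \<Longrightarrow> ivp_solution h s u y0 y \<Longrightarrow>
           s + \<tau>0 \<le> t \<Longrightarrow> t < u \<Longrightarrow> V (y t) \<le> V y0 - \<eta> z"
    by metis
  have "K \<subseteq> (\<Union>z\<in>K. ball z (r z))"
    by (rule subsetI, rule UN_I, assumption) (simp add: r)
  then obtain F where F: "F \<subseteq> K" "finite F" "K \<subseteq> (\<Union>z\<in>F. ball z (r z))"
    using compactE_image[OF \<open>compact K\<close>, of K "\<lambda>z. ball z (r z)"] by auto
  define m where "m = Min (insert 1 (\<eta> ` F))"
  show ?thesis
  proof (intro exI[of _ m] conjI allI impI)
    show "m > 0" using F \<eta> by (auto simp: m_def)
    fix y0 y s u t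
    assume y0: "\<epsilon> \<le> V y0" "norm y0 \<le> R" and y: "ivp_solution h s u y0 y" and t: "s + \<tau>0 \<le> t" "t < u"
    have "y0 \<in> K" using y0 by (simp add: K_def)
    then obtain z where z: "z \<in> F" "dist y0 z < r z" using F(3) by (auto simp: dist_commute)
    have "m \<le> \<eta> z" using z F(2) by (auto simp: m_def)
    then show "V (y t) \<le> V y0 - m" using drop[OF _ z(2) y t] z(1) F(1) by force
  qed
qed

end

section \<open>Single paths: tracking the ODE and convergence\<close>

definition noise_sum :: "(nat \<Rightarrow> real) \<Rightarrow> (nat \<Rightarrow> 'a::real_vector) \<Rightarrow> nat \<Rightarrow> nat \<Rightarrow> 'a" where
  "noise_sum a M n j = (\<Sum>m<j. a (n + m) *\<^sub>R M (Suc (n + m)))"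

lemma noise_sum_0 [simp]: "noise_sum a M n 0 = 0"
  by (simp add: noise_sum_def)

lemma noise_sum_Suc: "noise_sum a M n (Suc j) = noise_sum a M n j + a (n + j) *\<^sub>R M (Suc (n + j))"
  by (simp add: noise_sum_def)

lemma norm_triangle3:
  fixes u v w :: "'a::real_normed_vector"
  shows "norm (u + v + w) \<le> norm u + norm v + norm w"
  using norm_triangle_ineq[of "u + v" w] norm_triangle_ineq[of u v] by linarith

text \<open>
  Above the level \<open>e\<close> the sequence loses a fixed amount in every step, so it gets below \<open>e\<close>; from
  there it can rise to at most \<open>2 e\<close> before it falls again.
\<close>

lemma eventually_below_if_drops_above:
  fixes v :: "nat \<Rightarrow> real"
  assumes \<eta>: "\<eta> > 0" and v: "\<And>i. v i \<ge> 0"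
    and up: "\<And>i. i \<ge> N \<Longrightarrow> v (Suc i) \<le> v i + e"
    and drop: "\<And>i. i \<ge> N \<Longrightarrow> v i \<ge> e \<Longrightarrow> v (Suc i) \<le> v i - \<eta>"
  shows "eventually (\<lambda>i. v i \<le> 2 * e) sequentially"
proof -
  have "\<exists>i\<ge>N. v i < e"
  proof (rule ccontr)
    assume "\<not> ?thesis"
    then have big: "v i \<ge> e" if "i \<ge> N" for i using that by (auto simp: not_less)
    have dec: "v (N + k) \<le> v N - real k * \<eta>" for k
    proof (induction k)
      case (Suc k)
      then show ?case using drop[of "N + k"] big[of "N + k"] by (simp add: algebra_simps)
    qed simp
    obtain k where "real k * \<eta> > v N"
      using reals_Archimedean3[OF \<eta>] by blast
    then show False using dec[of k] v[of "N + k"] by linarith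
  qed
  then obtain i0 where i0: "i0 \<ge> N" "v i0 < e" by blast
  have "v (i0 + k) \<le> 2 * e" for k
  proof (induction k)
    case 0
    then show ?case using i0 v[of i0] by simp
  next
    case (Suc k)
    then show ?case
      using up[of "i0 + k"] drop[of "i0 + k"] i0 \<eta> by (cases "v (i0 + k) \<ge> e") auto
  qed
  then show ?thesis
    unfolding eventually_sequentially by (metis le_add_diff_inverse)
qed

locale sa_model = step_blocks a T \<gamma> + lyapunov_ode h gradV V L
  for a :: "nat \<Rightarrow> real" and T \<gamma> :: real
    and h gradV :: "'a::euclidean_space \<Rightarrow> 'a" and V :: "'a \<Rightarrow> real" and L :: real
begin

definition path_radius :: "real \<Rightarrow> real \<Rightarrow> real" where
  "path_radius R \<delta> = (R + norm (h 0) * horizon + \<delta>) * exp (L * horizon)"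

lemma iterate_eq:
  assumes "\<And>n. x (Suc n) = x n + a n *\<^sub>R (h (x n) + M (Suc n))"
  shows "x (n + j) = x n + (\<Sum>m<j. a (n + m) *\<^sub>R h (x (n + m))) + noise_sum a M n j"
  by (induction j) (simp_all add: noise_sum_Suc assms algebra_simps)

text \<open>
  The point of this bound is that it looks only at the noise accumulated up to step \<open>j\<close>. It
  therefore holds up to and including the first moment at which the noise becomes large, and it
  turns noise bounds relative to \<open>1 + \<parallel>x\<parallel>\<close> into absolute ones.
\<close>

lemma path_bounded_in_block:
  assumes x: "\<And>n. x (Suc n) = x n + a n *\<^sub>R (h (x n) + M (Suc n))"
    and R: "norm (x (idx n0 i)) \<le> R"
    and j: "idx n0 i + j \<le> idx n0 (Suc i)"
    and noise: "\<And>k. k \<le> j \<Longrightarrow> norm (noise_sum a M (idx n0 i) k) \<le> \<delta>"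
  shows "norm (x (idx n0 i + j)) \<le> path_radius R \<delta>"
proof -
  let ?n = "idx n0 i"
  define c where "c = R + norm (h 0) * horizon + \<delta>"
  have "\<delta> \<ge> 0" using noise[of 0] by simp
  then have c: "c \<ge> 0" using order_trans[OF norm_ge_zero R] horizon_pos
    by (simp add: c_def)
  have "norm (x (?n + j)) \<le> c * exp (\<Sum>m<j. L * a (?n + m))"
  proof (rule discrete_gronwall[where N = j, OF _ c _ order_refl])
    show "0 \<le> L * a (?n + m)" for m by (simp add: L_nonneg a_nonneg)
    fix k assume k: "k \<le> j"
    have "norm (\<Sum>m<k. a (?n + m) *\<^sub>R h (x (?n + m)))
        \<le> (\<Sum>m<k. norm (h 0) * a (?n + m) + L * a (?n + m) * norm (x (?n + m)))"
    proof (rule sum_norm_le)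
      fix m
      have "norm (a (?n + m) *\<^sub>R h (x (?n + m))) \<le> a (?n + m) * (norm (h 0) + L * norm (x (?n + m)))"
        using mult_left_mono[OF h_growth[of "x (?n + m)"] a_nonneg[of "?n + m"]]
        by (simp add: a_nonneg)
      then show "norm (a (?n + m) *\<^sub>R h (x (?n + m)))
          \<le> norm (h 0) * a (?n + m) + L * a (?n + m) * norm (x (?n + m))"
        by (simp add: algebra_simps)
    qed
    also have "\<dots> = norm (h 0) * (\<Sum>m<k. a (?n + m)) + (\<Sum>m<k. L * a (?n + m) * norm (x (?n + m)))"
      by (simp add: sum.distrib sum_distrib_left)
    also have "norm (h 0) * (\<Sum>m<k. a (?n + m)) \<le> norm (h 0) * horizon"
      using j k by (intro mult_left_mono block_time_le) auto
    finally have 1: "norm (\<Sum>m<k. a (?n + m) *\<^sub>R h (x (?n + m)))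
        \<le> norm (h 0) * horizon + (\<Sum>m<k. L * a (?n + m) * norm (x (?n + m)))" by simp
    have "norm (x (?n + k)) \<le> norm (x ?n) + norm (\<Sum>m<k. a (?n + m) *\<^sub>R h (x (?n + m)))
        + norm (noise_sum a M ?n k)"
      unfolding iterate_eq[where x = x and n = ?n and j = k, OF x] by (rule norm_triangle3)
    then show "norm (x (?n + k)) \<le> c + (\<Sum>m<k. L * a (?n + m) * norm (x (?n + m)))"
      using 1 noise[OF k] R by (simp add: c_def)
  qed
  also have "\<dots> \<le> c * exp (L * horizon)"
    using c mult_left_mono[OF block_time_le[OF j] L_nonneg]
    by (intro mult_left_mono) (auto simp: sum_distrib_left)
  finally show ?thesis by (simp add: path_radius_def c_def)
qed

text \<open>
  The difference between iterates and solution satisfies a discrete Gronwall inequality, driven by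
  the accumulated noise and by the local Euler errors \<open>O(a\<^sup>2)\<close>. The latter add up to a multiple of
  \<open>a (idx n0 i)\<close>, because the steps in a block are comparable and the block has bounded duration.
\<close>

lemma path_tracks_ode:
  assumes x: "\<And>n. x (Suc n) = x n + a n *\<^sub>R (h (x n) + M (Suc n))"
    and y: "ivp_solution h (tm (idx n0 i)) (tm (idx n0 (Suc i))) (x (idx n0 i)) y"
    and C: "\<And>t. t \<in> {tm (idx n0 i)..<tm (idx n0 (Suc i))} \<Longrightarrow> norm (h (y t)) \<le> C"
    and j: "idx n0 i + j < idx n0 (Suc i)"
    and noise: "\<And>k. k \<le> j \<Longrightarrow> norm (noise_sum a M (idx n0 i) k) \<le> \<delta>"
  shows "norm (x (idx n0 i + j) - y (tm (idx n0 i + j)))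
           \<le> (\<delta> + L * C * \<gamma> * a (idx n0 i) * horizon) * exp (L * horizon)"
proof -
  let ?n = "idx n0 i"
  let ?y = "\<lambda>k. y (tm (?n + k))"
  define c where "c = \<delta> + L * C * \<gamma> * a ?n * horizon"
  have "C \<ge> 0" using order_trans[OF norm_ge_zero C[of "tm ?n"]] idx_less_Suc[of n0 i]
    by (simp add: tm_less_iff)
  moreover have "\<delta> \<ge> 0" using noise[of 0] by simp
  ultimately have c: "c \<ge> 0" using horizon_pos L_nonneg \<gamma>_pos a_nonneg[of ?n]
    by (auto simp: c_def intro!: add_nonneg_nonneg mult_nonneg_nonneg)
  define r where "r m = ?y (Suc m) - ?y m - a (?n + m) *\<^sub>R h (?y m)" for m
  have r: "norm (r m) \<le> L * C * \<gamma> * a ?n * a (?n + m)" if "m < j" for m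
  proof -
    have "norm (r m) \<le> L * C * (a (?n + m))\<^sup>2"
      using ivp_solution_euler_step[OF h_lipschitz y C, of "tm (?n + m)" "tm (?n + Suc m)"] that j
      by (simp add: r_def tm_Suc[of "?n + m"] tm_le_iff a_nonneg)
        (use tm_less_iff[of "Suc (?n + m)" "idx n0 (Suc i)"] in \<open>simp add: tm_Suc\<close>)
    also have "\<dots> \<le> L * C * (\<gamma> * a ?n * a (?n + m))"
      unfolding power2_eq_square using that j block_step_le(1)[of n0 i m] \<open>C \<ge> 0\<close> L_nonneg
      by (intro mult_left_mono mult_right_mono) (auto simp: a_nonneg)
    finally show ?thesis by (simp add: mult_ac)
  qed
  have y_eq: "?y k = x ?n + (\<Sum>m<k. a (?n + m) *\<^sub>R h (?y m)) + (\<Sum>m<k. r m)" for k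
  proof (induction k)
    case 0
    show ?case using ivp_solution_start[OF y] by simp
  next
    case (Suc k)
    have "?y (Suc k) = ?y k + a (?n + k) *\<^sub>R h (?y k) + r k" by (simp add: r_def)
    then show ?case using Suc by simp
  qed
  have "norm (x (?n + j) - ?y j) \<le> c * exp (\<Sum>m<j. L * a (?n + m))"
  proof (rule discrete_gronwall[where N = j, OF _ c _ order_refl])
    show "0 \<le> L * a (?n + m)" for m by (simp add: L_nonneg a_nonneg)
    fix k assume k: "k \<le> j"
    let ?D = "\<Sum>m<k. a (?n + m) *\<^sub>R (h (x (?n + m)) - h (?y m))"
    have D: "norm ?D \<le> (\<Sum>m<k. L * a (?n + m) * norm (x (?n + m) - ?y m))"
    proof (rule sum_norm_le)
      fix m
      show "norm (a (?n + m) *\<^sub>R (h (x (?n + m)) - h (?y m))) \<le> L * a (?n + m) * norm (x (?n + m) - ?y m)"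
        using mult_left_mono[OF h_diff_le[of "x (?n + m)" "?y m"] a_nonneg[of "?n + m"]]
        by (simp add: a_nonneg mult_ac)
    qed
    have "norm (\<Sum>m<k. r m) \<le> (\<Sum>m<k. L * C * \<gamma> * a ?n * a (?n + m))"
      by (rule sum_norm_le) (use r k in auto)
    also have "\<dots> = L * C * \<gamma> * a ?n * (\<Sum>m<k. a (?n + m))" by (simp add: sum_distrib_left)
    also have "\<dots> \<le> L * C * \<gamma> * a ?n * horizon"
      using j k \<open>C \<ge> 0\<close> L_nonneg \<gamma>_pos a_nonneg[of ?n]
      by (intro mult_left_mono block_time_le) auto
    finally have rs: "norm (\<Sum>m<k. r m) \<le> L * C * \<gamma> * a ?n * horizon" .
    have "x (?n + k) - ?y k = ?D + noise_sum a M ?n k - (\<Sum>m<k. r m)"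
      unfolding y_eq[of k] iterate_eq[where x = x and n = ?n and j = k, OF x] by (simp add: scaleR_diff_right sum_subtractf)
    then have "norm (x (?n + k) - ?y k) \<le> norm ?D + norm (noise_sum a M ?n k) + norm (\<Sum>m<k. r m)"
      using norm_triangle_ineq4[of "?D + noise_sum a M ?n k" "\<Sum>m<k. r m"]
        norm_triangle_ineq[of ?D "noise_sum a M ?n k"] by simp
    then show "norm (x (?n + k) - ?y k) \<le> c + (\<Sum>m<k. L * a (?n + m) * norm (x (?n + m) - ?y m))"
      using D rs noise[OF k] by (simp add: c_def)
  qed
  also have "\<dots> \<le> c * exp (L * horizon)"
    using c j mult_left_mono[OF block_time_le[of n0 i j] L_nonneg]
    by (intro mult_left_mono) (auto simp: sum_distrib_left)
  finally show ?thesis by (simp add: c_def)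
qed

text \<open>
  By coercivity the points are eventually in a fixed ball, and on the part of this ball at distance
  at least \<open>\<epsilon>\<close> from the zeros the continuous function \<open>V\<close> has a positive minimum.
\<close>

lemma infdist_zeros_tendsto_0:
  assumes "(\<lambda>n. V (x n)) \<longlonglongrightarrow> 0"
  shows "(\<lambda>n. infdist (x n) {y. V y = 0}) \<longlonglongrightarrow> 0"
proof (rule tendstoI)
  let ?H = "{y. V y = 0}"
  fix \<epsilon> :: real assume \<epsilon>: "\<epsilon> > 0"
  obtain R where R: "\<And>y. V y \<le> 1 \<Longrightarrow> norm y \<le> R" using sublevel_bounded[of 1] by blast
  define K where "K = {y. infdist y ?H \<ge> \<epsilon>} \<inter> cball 0 R"
  have K: "compact K" unfolding K_def
    by (intro closed_Int_compact closed_Collect_le continuous_intros) auto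
  have pos: "V y > 0" if "y \<in> K" for y
    using that V_nonneg[of y] \<epsilon> by (cases "V y = 0") (auto simp: K_def)
  have "\<exists>m>0. \<forall>y\<in>K. V y \<ge> m"
  proof (cases "K = {}")
    case False
    then obtain z where "z \<in> K" "\<forall>y\<in>K. V z \<le> V y"
      using continuous_attains_inf[OF K _ V_continuous_on] by blast
    then show ?thesis using pos by blast
  qed (auto intro: exI[of _ 1])
  then obtain m where m: "m > 0" "\<And>y. y \<in> K \<Longrightarrow> V y \<ge> m" by blast
  have "eventually (\<lambda>n. V (x n) < min m 1) sequentially"
    using order_tendstoD(2)[OF assms, of "min m 1"] m by simp
  then show "eventually (\<lambda>n. dist (infdist (x n) ?H) 0 < \<epsilon>) sequentially"
  proof eventually_elim
    case (elim n)
    then have "x n \<notin> K" "norm (x n) \<le> R" using m(2)[of "x n"] R[of "x n"] by auto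
    then show ?case by (auto simp: K_def infdist_nonneg)
  qed
qed

lemma in_some_block:
  assumes "n0 \<le> n"
  obtains i j where "n = idx n0 i + j" "idx n0 i + j < idx n0 (Suc i)"
proof -
  define i where "i = (LEAST k. n < idx n0 (Suc k))"
  have "n < idx n0 (Suc n)" using seq_suble[OF strict_mono_idx, of "Suc n" n0] by simp
  then have 1: "n < idx n0 (Suc i)" unfolding i_def by (rule LeastI)
  have 2: "idx n0 i \<le> n"
  proof (cases i)
    case (Suc k)
    then have "\<not> n < idx n0 (Suc k)" using not_less_Least[of k "\<lambda>k. n < idx n0 (Suc k)"] by (simp add: i_def)
    then show ?thesis using Suc by simp
  qed (use assms in simp)
  show thesis by (rule that[of i "n - idx n0 i"]) (use 1 2 in auto)
qed

text \<open>
  Along a path that returns to a bounded set at the start of every block and whose noise over a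
  block tends to zero, the iterates follow the restarted solutions with vanishing error. Off the
  zeros of \<open>V\<close> a solution lowers \<open>V\<close> by a fixed amount in every block, and it never raises \<open>V\<close>; hence
  \<open>V\<close> tends to zero at the block starts and then also inside the blocks. Solutions are given only
  on half-open intervals, so at the end of a block they are compared with the iterates one step
  before the end, at the index \<open>last i\<close>.
\<close>

lemma path_converges:
  assumes x: "\<And>n. x (Suc n) = x n + a n *\<^sub>R (h (x n) + M (Suc n))"
    and y: "\<And>i. ivp_solution h (tm (idx n0 i)) (tm (idx n0 (Suc i))) (x (idx n0 i)) (y i)"
    and R: "\<And>i. norm (x (idx n0 i)) \<le> R"
    and noise: "\<And>\<epsilon>. \<epsilon> > 0 \<Longrightarrow> eventually (\<lambda>i. \<forall>k\<le>idx n0 (Suc i) - idx n0 i.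
            norm (noise_sum a M (idx n0 i) k) \<le> \<epsilon>) sequentially"
  shows "(\<lambda>n. infdist (x n) {y. V y = 0}) \<longlonglongrightarrow> 0"
proof -
  define N where "N i = idx n0 (Suc i) - idx n0 i" for i
  define last where "last i = idx n0 i + (N i - 1)" for i
  have N: "N i \<ge> 1" "idx n0 i + N i = idx n0 (Suc i)" "Suc (last i) = idx n0 (Suc i)" for i
    using idx_less_Suc[of n0 i] by (auto simp: N_def last_def)
  have "R \<ge> 0" using order_trans[OF norm_ge_zero R] .
  then have "\<exists>z\<in>cball 0 R. \<forall>w\<in>cball 0 R. V w \<le> V z"
    by (intro continuous_attains_sup compact_cball V_continuous_on) simp
  then obtain v0 where v0: "\<And>w. norm w \<le> R \<Longrightarrow> V w \<le> v0"
    by (metis mem_cball_0)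
  obtain R1 where R1: "R1 > 0" "\<And>w. V w \<le> v0 \<Longrightarrow> norm w \<le> R1"
    using sublevel_bounded by blast
  define C where "C = norm (h 0) + L * R1"
  have in_block: "tm (idx n0 i + j) \<in> {tm (idx n0 i)..<tm (idx n0 (Suc i))}" if "j < N i" for i j
    using that N(2)[of i] by (auto simp: tm_le_iff tm_less_iff)
  have Vy: "V (y i t) \<le> V (x (idx n0 i))" if "t \<in> {tm (idx n0 i)..<tm (idx n0 (Suc i))}" for i t
    using V_antimono[OF y[of i], of "tm (idx n0 i)" t] ivp_solution_start[OF y[of i]] that by simp
  have y_le: "norm (y i t) \<le> R1" if "t \<in> {tm (idx n0 i)..<tm (idx n0 (Suc i))}" for i t
    using R1(2) Vy[OF that] v0[OF R[of i]] by fastforce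
  have hy: "norm (h (y i t)) \<le> C" if "t \<in> {tm (idx n0 i)..<tm (idx n0 (Suc i))}" for i t
    using h_growth[of "y i t"] mult_left_mono[OF y_le[OF that] L_nonneg] by (simp add: C_def)

  have track: "eventually (\<lambda>i. (\<forall>j<N i. norm (x (idx n0 i + j) - y i (tm (idx n0 i + j))) \<le> \<epsilon>) \<and>
      norm (x (idx n0 (Suc i)) - y i (tm (last i))) \<le> \<epsilon>) sequentially" if \<epsilon>: "\<epsilon> > 0" for \<epsilon>
  proof -
    define e where "e = min \<epsilon> 1 / 6"
    have e: "e > 0" "e \<le> \<epsilon> / 6" "e \<le> 1/6" using \<epsilon> by (auto simp: e_def)
    define \<delta> where "\<delta> = min e (e * exp (- L * horizon))"
    have \<delta>: "\<delta> > 0" "\<delta> \<le> e" using e by (auto simp: \<delta>_def)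
    have \<delta>e: "\<delta> * exp (L * horizon) \<le> e"
    proof -
      have "\<delta> * exp (L * horizon) \<le> e * exp (- L * horizon) * exp (L * horizon)"
        by (intro mult_right_mono) (auto simp: \<delta>_def)
      then show ?thesis by (simp add: exp_add[symmetric] mult.assoc)
    qed
    have "(\<lambda>i. L * C * \<gamma> * a (idx n0 i) * horizon * exp (L * horizon)) \<longlonglongrightarrow> L * C * \<gamma> * 0 * horizon * exp (L * horizon)"
      by (intro tendsto_intros a_idx_tendsto_0)
    then have 1: "eventually (\<lambda>i. L * C * \<gamma> * a (idx n0 i) * horizon * exp (L * horizon) < e) sequentially"
      by (rule order_tendstoD(2)) (use e in simp)
    have "(\<lambda>i. \<gamma> * a (idx n0 i) * (norm (h 0) + L * (R1 + 1))) \<longlonglongrightarrow> \<gamma> * 0 * (norm (h 0) + L * (R1 + 1))"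
      by (intro tendsto_intros a_idx_tendsto_0)
    then have 2: "eventually (\<lambda>i. \<gamma> * a (idx n0 i) * (norm (h 0) + L * (R1 + 1)) < e) sequentially"
      by (rule order_tendstoD(2)) (use e in simp)
    show ?thesis using 1 2 noise[OF \<delta>(1)]
    proof eventually_elim
      case (elim i)
      let ?n = "idx n0 i"
      have close: "norm (x (?n + j) - y i (tm (?n + j))) \<le> 2 * e" if j: "j < N i" for j
      proof -
        have "norm (x (?n + j) - y i (tm (?n + j)))
            \<le> (\<delta> + L * C * \<gamma> * a ?n * horizon) * exp (L * horizon)"
          by (rule path_tracks_ode[OF x y hy]) (use j N(2)[of i] elim(3) in \<open>auto simp: N_def\<close>)
        then show ?thesis using elim(1) \<delta>e unfolding distrib_right by linarith
      qed
      let ?k = "N i - 1"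
      have k: "?k < N i" "last i = ?n + ?k" "Suc ?k = N i" using N(1)[of i] by (auto simp: last_def)
      have close_k: "norm (x (last i) - y i (tm (last i))) \<le> 2 * e"
        using close[OF k(1)] by (simp add: last_def)
      have "norm (x (last i)) \<le> R1 + 1"
      proof -
        have "norm (y i (tm (last i))) \<le> R1" using y_le[OF in_block[OF k(1)]] by (simp add: last_def)
        then show ?thesis using close_k norm_triangle_sub[of "x (last i)" "y i (tm (last i))"] e by linarith
      qed
      then have "norm (h (x (last i))) \<le> norm (h 0) + L * (R1 + 1)"
        using h_growth[of "x (last i)"] mult_left_mono[OF _ L_nonneg] by fastforce
      then have "a (last i) * norm (h (x (last i))) \<le> \<gamma> * a ?n * (norm (h 0) + L * (R1 + 1))"
        using block_step_le(1)[of n0 i ?k] k N(2)[of i] a_nonneg \<gamma>_pos by (intro mult_mono) auto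
      then have drift: "a (last i) * norm (h (x (last i))) \<le> e" using elim(2) by linarith
      have "a (last i) *\<^sub>R M (Suc (last i)) = noise_sum a M ?n (N i) - noise_sum a M ?n ?k"
        using noise_sum_Suc[of a M ?n ?k] k by simp
      moreover have "norm (noise_sum a M ?n (N i) - noise_sum a M ?n ?k) \<le> \<delta> + \<delta>"
        using elim(3) by (intro order_trans[OF norm_triangle_ineq4] add_mono) (auto simp: N_def)
      ultimately have last_noise: "norm (a (last i) *\<^sub>R M (Suc (last i))) \<le> 2 * e" using \<delta> by simp
      have "x (idx n0 (Suc i)) - y i (tm (last i))
          = (x (last i) - y i (tm (last i))) + a (last i) *\<^sub>R h (x (last i)) + a (last i) *\<^sub>R M (Suc (last i))"
        unfolding N(3)[symmetric] x by (simp add: algebra_simps)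
      also have "norm \<dots> \<le> norm (x (last i) - y i (tm (last i))) + norm (a (last i) *\<^sub>R h (x (last i)))
          + norm (a (last i) *\<^sub>R M (Suc (last i)))"
        by (rule norm_triangle3)
      also have "norm (a (last i) *\<^sub>R h (x (last i))) = a (last i) * norm (h (x (last i)))"
        by (simp add: a_nonneg)
      finally have "norm (x (idx n0 (Suc i)) - y i (tm (last i))) \<le> \<epsilon>"
        using close_k drift last_noise e by linarith
      moreover have "\<forall>j<N i. norm (x (?n + j) - y i (tm (?n + j))) \<le> \<epsilon>"
      proof (intro allI impI)
        fix j assume "j < N i"
        show "norm (x (?n + j) - y i (tm (?n + j))) \<le> \<epsilon>"
          using close[OF \<open>j < N i\<close>] e by linarith
      qed
      ultimately show ?case by simp
    qed
  qed

  have V_close: "eventually (\<lambda>i. (\<forall>j<N i. V (x (idx n0 i + j)) \<le> V (y i (tm (idx n0 i + j))) + \<epsilon>) \<and>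
      V (x (idx n0 (Suc i))) \<le> V (y i (tm (last i))) + \<epsilon>) sequentially" if \<epsilon>: "\<epsilon> > 0" for \<epsilon>
  proof -
    have "uniformly_continuous_on (cball 0 (R1 + 1)) V"
      by (intro compact_uniformly_continuous V_continuous_on compact_cball)
    then obtain d where d: "d > 0" "\<And>w w'. w \<in> cball 0 (R1 + 1) \<Longrightarrow> w' \<in> cball 0 (R1 + 1) \<Longrightarrow>
        dist w w' < d \<Longrightarrow> dist (V w) (V w') < \<epsilon>"
      unfolding uniformly_continuous_on_def using \<epsilon> by metis
    have V_le: "V w \<le> V w' + \<epsilon>" if "norm w' \<le> R1" "norm (w - w') \<le> min 1 (d / 2)" for w w'
    proof -
      have "norm w \<le> R1 + 1" using norm_triangle_sub[of w w'] that by simp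
      then have "dist (V w) (V w') < \<epsilon>" using that d(1) by (intro d(2)) (auto simp: dist_norm)
      then show ?thesis by (simp add: dist_real_def)
    qed
    have "min 1 (d / 2) > 0" using d by simp
    from track[OF this] show ?thesis
    proof eventually_elim
      case (elim i)
      have "norm (y i (tm (idx n0 i + j))) \<le> R1" if "j < N i" for j
        using y_le[OF in_block[OF that]] .
      moreover from this[of "N i - 1"] have "norm (y i (tm (last i))) \<le> R1"
        using N(1)[of i] by (simp add: last_def)
      ultimately show ?case using elim V_le by blast
    qed
  qed

  have "(\<lambda>i. \<gamma> * a (idx n0 i)) \<longlonglongrightarrow> \<gamma> * 0"
    by (intro tendsto_intros a_idx_tendsto_0)
  then have "eventually (\<lambda>i. \<gamma> * a (idx n0 i) < T / 2) sequentially"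
    by (rule order_tendstoD(2)) (use T_pos in simp)
  \<comment> \<open>the last step time is late enough in the block for the uniform drop of \<open>V\<close> to have happened\<close>
  then have late: "eventually (\<lambda>i. tm (idx n0 i) + T / 2 \<le> tm (last i)) sequentially"
  proof eventually_elim
    case (elim i)
    have "a (last i) \<le> \<gamma> * a (idx n0 i)"
      using block_step_le(1)[of n0 i "N i - 1"] N[of i] by (simp add: last_def)
    then show ?case
      using tm_idx_Suc_ge[of n0 i] elim by (simp add: N(3)[symmetric] tm_Suc)
  qed

  have V_small: "eventually (\<lambda>n. V (x n) \<le> 3 * e) sequentially" if e: "e > 0" for e
  proof -
    obtain \<eta> where \<eta>: "\<eta> > 0" and drop: "\<And>y0 y s u t. V y0 \<ge> e \<Longrightarrow> norm y0 \<le> R \<Longrightarrow>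
        ivp_solution h s u y0 y \<Longrightarrow> s + T / 2 \<le> t \<Longrightarrow> t < u \<Longrightarrow> V (y t) \<le> V y0 - \<eta>"
      using V_uniform_drop[OF e, of "T / 2" R] T_pos by auto
    have "min (\<eta> / 2) e > 0" using \<eta> e by simp
    from eventually_conj[OF V_close[OF this] late]
    obtain I where I: "\<And>i j. i \<ge> I \<Longrightarrow> j < N i \<Longrightarrow> V (x (idx n0 i + j)) \<le> V (y i (tm (idx n0 i + j))) + min (\<eta> / 2) e"
      "\<And>i. i \<ge> I \<Longrightarrow> V (x (idx n0 (Suc i))) \<le> V (y i (tm (last i))) + min (\<eta> / 2) e"
      "\<And>i. i \<ge> I \<Longrightarrow> tm (idx n0 i) + T / 2 \<le> tm (last i)"
      unfolding eventually_sequentially by auto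
    have last_in: "tm (last i) \<in> {tm (idx n0 i)..<tm (idx n0 (Suc i))}" for i
      using in_block[of "N i - 1" i] N(1)[of i] by (simp add: last_def)
    have "eventually (\<lambda>i. V (x (idx n0 i)) \<le> 2 * e) sequentially"
    proof (rule eventually_below_if_drops_above[where \<eta> = "\<eta> / 2" and N = I])
      show "V (x (idx n0 (Suc i))) \<le> V (x (idx n0 i)) + e" if "i \<ge> I" for i
        using I(2)[OF that] Vy[OF last_in[of i]] by linarith
      show "V (x (idx n0 (Suc i))) \<le> V (x (idx n0 i)) - \<eta> / 2" if "i \<ge> I" "V (x (idx n0 i)) \<ge> e" for i
        using I(2)[OF that(1)] drop[OF that(2) R y[of i] I(3)[OF that(1)]] last_in[of i] by simp
    qed (use \<eta> V_nonneg in auto)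
    then obtain I2 where I2: "\<And>i. i \<ge> I2 \<Longrightarrow> V (x (idx n0 i)) \<le> 2 * e"
      unfolding eventually_sequentially by blast
    show ?thesis unfolding eventually_sequentially
    proof (intro exI[of _ "idx n0 (max I I2)"] allI impI)
      fix n assume n: "idx n0 (max I I2) \<le> n"
      have "n0 \<le> n" using n n0_le_idx[of n0 "max I I2"] by simp
      then obtain i j where ij: "n = idx n0 i + j" "idx n0 i + j < idx n0 (Suc i)"
        by (rule in_some_block)
      have "max I I2 \<le> i"
      proof (rule ccontr)
        assume "\<not> max I I2 \<le> i"
        then have "idx n0 (Suc i) \<le> idx n0 (max I I2)" by (intro idx_mono) (simp only: not_le Suc_le_eq)
        then show False using n ij by simp
      qed
      moreover have "j < N i" using ij by (simp add: N_def)
      ultimately show "V (x n) \<le> 3 * e"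
        using I(1)[of i j] I2[of i] Vy[OF in_block[of j i]] ij(1) by simp
    qed
  qed
  have "(\<lambda>n. V (x n)) \<longlonglongrightarrow> 0"
  proof (rule tendstoI)
    fix e :: real assume "e > 0"
    then have "eventually (\<lambda>n. V (x n) \<le> 3 * (e / 6)) sequentially" by (intro V_small) simp
    then show "eventually (\<lambda>n. dist (V (x n)) 0 < e) sequentially"
      by eventually_elim (use \<open>e > 0\<close> V_nonneg in \<open>auto simp: dist_real_def\<close>)
  qed
  then show ?thesis by (rule infdist_zeros_tendsto_0)
qed

end

section \<open>Measurability of the tracking error\<close>

text \<open>
  Each preimage of an open set under \<open>g\<close> is the preimage under \<open>f\<close> of a union of balls, so \<open>g\<close>
  inherits measurability from \<open>f\<close> without any extension of the induced Lipschitz map beyond the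
  range of \<open>f\<close>.
\<close>

lemma borel_measurable_if_lipschitz_in_measurable:
  fixes f :: "'w \<Rightarrow> 'a::real_normed_vector" and g :: "'w \<Rightarrow> 'b::real_normed_vector"
  assumes f: "f \<in> borel_measurable F"
    and lip: "\<And>\<omega> \<omega>'. \<omega> \<in> space F \<Longrightarrow> \<omega>' \<in> space F \<Longrightarrow> norm (g \<omega> - g \<omega>') \<le> C * norm (f \<omega> - f \<omega>')"
  shows "g \<in> borel_measurable F"
proof (rule borel_measurableI)
  fix S :: "'b set" assume S: "open S"
  define D where "D = \<bar>C\<bar> + 1"
  have D: "D > 0" "C \<le> D" by (auto simp: D_def)
  have lipD: "norm (g \<omega> - g \<omega>') \<le> D * norm (f \<omega> - f \<omega>')" if "\<omega> \<in> space F" "\<omega>' \<in> space F" for \<omega> \<omega>'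
    using lip[OF that] mult_right_mono[OF D(2) norm_ge_zero] by (rule order_trans)
  define W where "W = (\<Union>(\<omega>, r)\<in>{(\<omega>, r). \<omega> \<in> space F \<and> ball (g \<omega>) r \<subseteq> S}. ball (f \<omega>) (r / D))"
  have "open W" by (auto simp: W_def)
  have "g -` S \<inter> space F = f -` W \<inter> space F"
  proof (intro equalityI subsetI)
    fix \<omega> assume w: "\<omega> \<in> g -` S \<inter> space F"
    then obtain r where r: "r > 0" "ball (g \<omega>) r \<subseteq> S" using S open_contains_ball by blast
    have "f \<omega> \<in> ball (f \<omega>) (r / D)" using r D by simp
    then have "f \<omega> \<in> W" using w r(2) unfolding W_def by blast
    then show "\<omega> \<in> f -` W \<inter> space F" using w by simp
  next
    fix \<omega> assume w: "\<omega> \<in> f -` W \<inter> space F"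
    then obtain \<omega>' r where r: "\<omega>' \<in> space F" "ball (g \<omega>') r \<subseteq> S" "f \<omega> \<in> ball (f \<omega>') (r / D)"
      unfolding W_def by auto
    have "norm (g \<omega>' - g \<omega>) \<le> D * norm (f \<omega>' - f \<omega>)" using lipD r w by simp
    also have "\<dots> < r" using r(3) D by (simp add: dist_norm field_simps)
    finally have "g \<omega> \<in> ball (g \<omega>') r" by (simp add: dist_norm)
    then show "\<omega> \<in> g -` S \<inter> space F" using r w by auto
  qed
  also have "\<dots> \<in> sets F" using f \<open>open W\<close> by (simp add: measurable_sets)
  finally show "g -` S \<inter> space F \<in> sets F" .
qed

text \<open>
  Right continuity lets rational times decide whether the supremum exceeds a level, even if
  the left end point of the interval is irrational.
\<close>

lemma borel_measurable_SUP_right_continuous: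
  fixes z :: "real \<Rightarrow> 'w \<Rightarrow> real"
  assumes su: "s < u"
    and meas: "\<And>t. t \<in> {s..<u} \<Longrightarrow> z t \<in> borel_measurable F"
    and cont: "\<And>\<omega> t. \<omega> \<in> space F \<Longrightarrow> t \<in> {s..<u} \<Longrightarrow> continuous (at_right t) (\<lambda>t. z t \<omega>)"
    and bdd: "\<And>\<omega>. \<omega> \<in> space F \<Longrightarrow> bdd_above ((\<lambda>t. z t \<omega>) ` {s..<u})"
  shows "(\<lambda>\<omega>. SUP t\<in>{s..<u}. z t \<omega>) \<in> borel_measurable F"
  unfolding borel_measurable_iff_le
proof
  fix c
  have "(SUP t\<in>{s..<u}. z t \<omega>) \<le> c \<longleftrightarrow> (\<forall>q::rat. of_rat q \<in> {s..<u} \<longrightarrow> z (of_rat q) \<omega> \<le> c)"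
    if \<omega>: "\<omega> \<in> space F" for \<omega>
  proof
    assume "(SUP t\<in>{s..<u}. z t \<omega>) \<le> c"
    then show "\<forall>q::rat. of_rat q \<in> {s..<u} \<longrightarrow> z (of_rat q) \<omega> \<le> c"
      using cSUP_upper[OF _ bdd[OF \<omega>]] by (meson order_trans)
  next
    assume rat: "\<forall>q::rat. of_rat q \<in> {s..<u} \<longrightarrow> z (of_rat q) \<omega> \<le> c"
    show "(SUP t\<in>{s..<u}. z t \<omega>) \<le> c"
    proof (rule cSUP_least)
      fix t assume t: "t \<in> {s..<u}"
      show "z t \<omega> \<le> c"
      proof (rule ccontr)
        assume "\<not> z t \<omega> \<le> c"
        then have "eventually (\<lambda>r. z r \<omega> > c) (at_right t)"
          using cont[OF \<omega> t] unfolding continuous_within by (intro order_tendstoD(1)) auto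
        then obtain v where v: "v > t" "\<And>r. t < r \<Longrightarrow> r < v \<Longrightarrow> z r \<omega> > c"
          unfolding eventually_at_right_field by blast
        have "t < min v u" using v t by simp
        then obtain q where "q \<in> \<rat>" "t < q" "q < min v u" using Rats_dense_in_real by blast
        then obtain p where "t < of_rat p" "of_rat p < min v u" by (auto elim!: Rats_cases)
        then show False using rat v(2) t by force
      qed
    qed (use su in auto)
  qed
  then have "{\<omega> \<in> space F. (SUP t\<in>{s..<u}. z t \<omega>) \<le> c}
      = {\<omega> \<in> space F. \<forall>q::rat. of_rat q \<in> {s..<u} \<longrightarrow> z (of_rat q) \<omega> \<le> c}"
    by blast
  also have "\<dots> \<in> sets F"
  proof (rule sets.sets_Collect_countable_All)
    fix q :: rat
    show "{\<omega> \<in> space F. of_rat q \<in> {s..<u} \<longrightarrow> z (of_rat q) \<omega> \<le> c} \<in> sets F"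
      using meas[of "of_rat q"] by (cases "(of_rat q :: real) \<in> {s..<u}") (auto simp: borel_measurable_iff_le)
  qed
  finally show "{\<omega> \<in> space F. (SUP t\<in>{s..<u}. z t \<omega>) \<le> c} \<in> sets F" .
qed

context step_blocks begin

lemma sa_interp_eq:
  assumes "tm n \<le> t" "t < tm (Suc n)"
  shows "sa_interp a x t = x n + ((t - tm n) / a n) *\<^sub>R (x (Suc n) - x n)"
proof -
  have "(LEAST m. t < tm (Suc m)) = n"
  proof (rule Least_equality)
    show "t < tm (Suc n)" by (rule assms(2))
  next
    fix m assume "t < tm (Suc m)"
    then have "tm n < tm (Suc m)" using assms(1) by simp
    then show "n \<le> m" by (simp add: tm_less_iff)
  qed
  then show ?thesis by (simp add: sa_interp_def)
qed

lemma time_in_step: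
  assumes "t \<in> {tm p..<tm q}"
  obtains n where "p \<le> n" "n < q" "tm n \<le> t" "t < tm (Suc n)"
proof -
  define n where "n = (LEAST m. t < tm (Suc m))"
  obtain k where "tm k \<ge> t + 1" using tm_unbounded by blast
  then have "t < tm (Suc k)" using tm_le_iff[of k "Suc k"] by simp
  then have 1: "t < tm (Suc n)" unfolding n_def by (rule LeastI)
  have 2: "tm n \<le> t"
  proof (cases n)
    case 0
    then show ?thesis using assms tm_le_iff[of 0 p] by simp
  next
    case (Suc m)
    then have "\<not> t < tm (Suc m)" using not_less_Least[of m "\<lambda>m. t < tm (Suc m)"] by (simp add: n_def)
    then show ?thesis using Suc by simp
  qed
  have "tm p < tm (Suc n)" "tm n < tm q" using 1 2 assms by auto
  then have "p \<le> n" "n < q" by (auto simp: tm_less_iff)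
  then show thesis using that 1 2 by blast
qed

lemma sa_interp_right_continuous:
  fixes x :: "nat \<Rightarrow> 'b::real_normed_vector"
  assumes "t \<in> {tm p..<tm q}"
  shows "continuous (at_right t) (sa_interp a x)"
proof -
  obtain n where n: "tm n \<le> t" "t < tm (Suc n)" using time_in_step[OF assms] by blast
  let ?g = "\<lambda>t. x n + ((t - tm n) / a n) *\<^sub>R (x (Suc n) - x n)"
  have g: "(?g \<longlongrightarrow> ?g t) (at_right t)" by (intro tendsto_intros) (use a_pos[of n] in auto)
  have "eventually (\<lambda>r. r \<in> {t<..<tm (Suc n)}) (at_right t)"
    by (rule eventually_at_rightI[OF _ n(2)]) simp
  then have "eventually (\<lambda>r. ?g r = sa_interp a x r) (at_right t)"
    by eventually_elim (use n in \<open>auto simp: sa_interp_eq[of n]\<close>)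
  from Lim_transform_eventually[OF g this] show ?thesis
    using n by (simp add: continuous_within sa_interp_eq[of n t])
qed

lemma norm_sa_interp_le:
  fixes x :: "nat \<Rightarrow> 'b::real_normed_vector"
  assumes "t \<in> {tm p..<tm q}"
  shows "norm (sa_interp a x t) \<le> (\<Sum>n<q. norm (x n) + norm (x (Suc n) - x n))"
proof -
  obtain n where n: "n < q" "tm n \<le> t" "t < tm (Suc n)" using time_in_step[OF assms] by blast
  have "(t - tm n) / a n \<le> 1" "(t - tm n) / a n \<ge> 0"
    using n a_pos[of n] by (auto simp: tm_Suc)
  then have "norm (((t - tm n) / a n) *\<^sub>R (x (Suc n) - x n)) \<le> 1 * norm (x (Suc n) - x n)"
    unfolding norm_scaleR by (intro mult_right_mono) auto
  then have "norm (sa_interp a x t) \<le> norm (x n) + norm (x (Suc n) - x n)"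
    using norm_triangle_ineq[of "x n" "((t - tm n) / a n) *\<^sub>R (x (Suc n) - x n)"]
    by (simp add: sa_interp_eq[OF n(2,3)])
  also have "\<dots> \<le> (\<Sum>n<q. norm (x n) + norm (x (Suc n) - x n))"
    using member_le_sum[of n "{..<q}" "\<lambda>n. norm (x n) + norm (x (Suc n) - x n)"] n by simp
  finally show ?thesis .
qed

lemma sa_interp_measurable:
  fixes x :: "nat \<Rightarrow> 'w \<Rightarrow> 'b::euclidean_space"
  assumes x: "\<And>m. m \<le> q \<Longrightarrow> x m \<in> borel_measurable F" and t: "t \<in> {tm p..<tm q}"
  shows "(\<lambda>\<omega>. sa_interp a (\<lambda>n. x n \<omega>) t) \<in> borel_measurable F"
proof -
  obtain n where n: "n < q" "tm n \<le> t" "t < tm (Suc n)" using time_in_step[OF t] by blast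
  have [measurable]: "x n \<in> borel_measurable F" "x (Suc n) \<in> borel_measurable F"
    using x n by auto
  show ?thesis unfolding sa_interp_eq[OF n(2,3)] by measurable
qed

end

context sa_model begin

text \<open>
  The restarted solutions are chosen separately for each outcome \<open>\<omega>\<close>. Uniqueness nevertheless makes
  their value at a fixed time a Lipschitz function of the starting point, hence measurable with
  respect to any \<open>\<sigma>\<close>-algebra that makes the iterates of the block measurable.
\<close>

lemma sa_rho_measurable:
  fixes x :: "nat \<Rightarrow> 'w \<Rightarrow> 'a"
  assumes x: "\<And>m. m \<le> idx n0 (Suc i) \<Longrightarrow> x m \<in> borel_measurable F"
    and sol: "\<And>\<omega>. \<omega> \<in> space F \<Longrightarrow>
          ivp_solution h (tm (idx n0 i)) (tm (idx n0 (Suc i))) (x (idx n0 i) \<omega>) (y \<omega> i)"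
  shows "(\<lambda>\<omega>. sa_rho a T n0 (\<lambda>n. x n \<omega>) (y \<omega>) i) \<in> borel_measurable F"
proof -
  define s where "s = tm (idx n0 i)"
  define u where "u = tm (idx n0 (Suc i))"
  have su: "s < u" by (simp add: s_def u_def tm_less_iff idx_less_Suc)
  note sol = sol[folded s_def u_def]
  have x_start: "x (idx n0 i) \<in> borel_measurable F" using x idx_less_Suc[of n0 i] by simp
  have "(\<lambda>\<omega>. SUP t\<in>{s..<u}. norm (sa_interp a (\<lambda>n. x n \<omega>) t - y \<omega> i t)) \<in> borel_measurable F"
  proof (rule borel_measurable_SUP_right_continuous[OF su])
    fix t assume t: "t \<in> {s..<u}"
    have [measurable]: "(\<lambda>\<omega>. y \<omega> i t) \<in> borel_measurable F"
      by (rule borel_measurable_if_lipschitz_in_measurable[OF x_start])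
        (rule ivp_solution_dist_le[OF h_lipschitz sol sol t])
    have [measurable]: "(\<lambda>\<omega>. sa_interp a (\<lambda>n. x n \<omega>) t) \<in> borel_measurable F"
      by (rule sa_interp_measurable[OF x]) (use t in \<open>auto simp: s_def u_def\<close>)
    show "(\<lambda>\<omega>. norm (sa_interp a (\<lambda>n. x n \<omega>) t - y \<omega> i t)) \<in> borel_measurable F"
      by measurable
  next
    fix \<omega> t assume \<omega>: "\<omega> \<in> space F" and t: "t \<in> {s..<u}"
    have "continuous (at t within {s..<u}) (y \<omega> i)"
      using ivp_solution_deriv[OF sol[OF \<omega>] t] by (rule has_vector_derivative_continuous)
    then have "(y \<omega> i \<longlongrightarrow> y \<omega> i t) (at t within {t<..<u})"
      unfolding continuous_within by (rule tendsto_within_subset) (use t in auto)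
    moreover have "at t within {t<..<u} = at_right t"
      using t by (intro at_within_nhd[where S = "{..<u}"]) auto
    ultimately have "continuous (at_right t) (y \<omega> i)" by (simp add: continuous_within)
    moreover have "continuous (at_right t) (sa_interp a (\<lambda>n. x n \<omega>))"
      by (rule sa_interp_right_continuous) (use t in \<open>auto simp: s_def u_def\<close>)
    ultimately show "continuous (at_right t) (\<lambda>t. norm (sa_interp a (\<lambda>n. x n \<omega>) t - y \<omega> i t))"
      by (intro continuous_intros)
  next
    fix \<omega> assume \<omega>: "\<omega> \<in> space F"
    obtain R where R: "\<And>w. V w \<le> V (x (idx n0 i) \<omega>) \<Longrightarrow> norm w \<le> R" using sublevel_bounded by blast
    define Q where "Q = (\<Sum>n<idx n0 (Suc i). norm (x n \<omega>) + norm (x (Suc n) \<omega> - x n \<omega>))"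
    have "norm (sa_interp a (\<lambda>n. x n \<omega>) t - y \<omega> i t) \<le> Q + R" if t: "t \<in> {s..<u}" for t
    proof -
      have "V (y \<omega> i t) \<le> V (y \<omega> i s)" using V_antimono[OF sol[OF \<omega>], of s t] t by simp
      then have "norm (y \<omega> i t) \<le> R" using R ivp_solution_start[OF sol[OF \<omega>]] by simp
      moreover have "norm (sa_interp a (\<lambda>n. x n \<omega>) t) \<le> Q"
        unfolding Q_def by (rule norm_sa_interp_le) (use t in \<open>auto simp: s_def u_def\<close>)
      ultimately show ?thesis using norm_triangle_ineq4[of "sa_interp a (\<lambda>n. x n \<omega>) t" "y \<omega> i t"] by linarith
    qed
    then show "bdd_above ((\<lambda>t. norm (sa_interp a (\<lambda>n. x n \<omega>) t - y \<omega> i t)) ` {s..<u})"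
      by (intro bdd_aboveI2)
  qed
  then show ?thesis by (simp add: sa_rho_def s_def u_def)
qed

lemma sa_good_measurable:
  fixes x :: "nat \<Rightarrow> 'w \<Rightarrow> 'a"
  assumes x: "\<And>m. m \<le> idx n0 i \<Longrightarrow> x m \<in> borel_measurable F" and B: "open B"
    and sol: "\<And>\<omega> k. \<omega> \<in> space F \<Longrightarrow>
          ivp_solution h (tm (idx n0 k)) (tm (idx n0 (Suc k))) (x (idx n0 k) \<omega>) (y \<omega> k)"
  shows "{\<omega> \<in> space F. sa_good a T B \<delta> n0 (\<lambda>n. x n \<omega>) (y \<omega>) i} \<in> sets F"
proof -
  have "{\<omega> \<in> space F. sa_rho a T n0 (\<lambda>n. x n \<omega>) (y \<omega>) k < \<delta>} \<in> sets F" if "k < i" for k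
  proof -
    have "m \<le> idx n0 i" if "m \<le> idx n0 (Suc k)" for m
      using that idx_mono[of "Suc k" i n0] \<open>k < i\<close> by simp
    then have "(\<lambda>\<omega>. sa_rho a T n0 (\<lambda>n. x n \<omega>) (y \<omega>) k) \<in> borel_measurable F"
      by (intro sa_rho_measurable x sol) auto
    then show ?thesis by (simp add: borel_measurable_iff_less)
  qed
  then have rho: "{\<omega> \<in> space F. \<forall>k\<in>{..<i}. sa_rho a T n0 (\<lambda>n. x n \<omega>) (y \<omega>) k < \<delta>} \<in> sets F"
    by (intro sets.sets_Collect_finite_All) auto
  have start: "{\<omega> \<in> space F. x n0 \<omega> \<in> B} \<in> sets F"
  proof -
    have "{\<omega> \<in> space F. x n0 \<omega> \<in> B} = x n0 -` B \<inter> space F" by auto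
    then show ?thesis using measurable_sets[OF x[of n0], of B] B n0_le_idx[of n0 i] by simp
  qed
  show ?thesis
    using sets.sets_Collect_conj[OF rho start] unfolding sa_good_def Ball_def lessThan_iff .
qed

end

section \<open>Exponential moments of conditionally centred variables\<close>

lemma exp_le_quadratic:
  fixes x :: real
  shows "exp x \<le> 1 + x + x\<^sup>2 * exp \<bar>x\<bar>"
proof -
  obtain t where t: "\<bar>t\<bar> \<le> \<bar>x\<bar>" "exp x = (\<Sum>m<2. x ^ m / fact m) + exp t / fact 2 * x ^ 2"
    using Maclaurin_exp_le[of x 2] by blast
  have "exp t / 2 * x\<^sup>2 \<le> exp \<bar>x\<bar> * x\<^sup>2"
  proof (rule mult_right_mono)
    have "exp t \<le> exp \<bar>x\<bar>" using t(1) by simp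
    then show "exp t / 2 \<le> exp \<bar>x\<bar>" using exp_gt_zero[of "\<bar>x\<bar>"] by linarith
  qed simp
  moreover have "(\<Sum>m<2. x ^ m / fact m) = 1 + x" by (simp add: numeral_2_eq_2)
  ultimately show ?thesis using t(2) by (simp add: fact_2 mult.commute)
qed

text \<open>
  The bound on \<open>E (exp (C2 / 2 * Z))\<close> that results from the tail bound \<open>C1 exp (- C2 k)\<close> at the integer
  levels \<open>k\<close>: a geometric series with ratio \<open>exp (- C2 / 2)\<close>.
\<close>

definition tail_moment :: "real \<Rightarrow> real \<Rightarrow> real" where
  "tail_moment C1 C2 = 1 + C1 * exp (C2 / 2) / (1 - exp (- (C2 / 2)))"

context prob_space begin

text \<open>
  A layer-cake estimate over integer levels. The weight \<open>W\<close>, measurable with respect to \<open>F\<close>, makes it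
  a statement about conditional expectations without having to form the conditional
  expectation of an unbounded function.
\<close>

lemma exp_moment_if_exp_tail:
  assumes F: "subalgebra M F"
    and W: "W \<in> borel_measurable F" "integrable M W" "\<And>\<omega>. W \<omega> \<ge> 0"
    and Z [measurable]: "Z \<in> borel_measurable M"
    and C: "C1 \<ge> 0" "C2 > 0"
    and tail: "\<And>k::nat. AE \<omega> in M. real_cond_exp M F (indicat_real {\<omega> \<in> space M. Z \<omega> > real k}) \<omega>
                  \<le> C1 * exp (- C2 * real k)"
  shows "integrable M (\<lambda>\<omega>. W \<omega> * exp (C2 / 2 * Z \<omega>))"
    and "(\<integral>\<omega>. W \<omega> * exp (C2 / 2 * Z \<omega>) \<partial>M) \<le> tail_moment C1 C2 * (\<integral>\<omega>. W \<omega> \<partial>M)"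
proof -
  interpret F: finite_measure_subalgebra M F by unfold_locales (rule F)
  have [measurable]: "W \<in> borel_measurable M" using W(2) by auto
  define c where "c = C2 / 2"
  have c: "c > 0" using C by (simp add: c_def)
  define E where "E k = {\<omega> \<in> space M. Z \<omega> > real k}" for k :: nat
  have [measurable]: "E k \<in> sets M" for k by (simp add: E_def)
  define I where "I = (\<integral>\<omega>. W \<omega> \<partial>M)"
  have I0: "I \<ge> 0" unfolding I_def using W(3) by (rule Bochner_Integration.integral_nonneg)
  have int: "integrable M (\<lambda>\<omega>. W \<omega> * indicat_real (E k) \<omega>)" for k
    using integrable_mult_indicator[OF _ W(2), of "E k"] by (simp add: mult.commute)
  have on_tail: "(\<integral>\<omega>. W \<omega> * indicat_real (E k) \<omega> \<partial>M) \<le> C1 * exp (- C2 * real k) * I" for k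
  proof -
    have "(\<integral>\<omega>. W \<omega> * indicat_real (E k) \<omega> \<partial>M)
        = (\<integral>\<omega>. W \<omega> * real_cond_exp M F (indicat_real (E k)) \<omega> \<partial>M)"
      by (rule F.real_cond_exp_intg(2)[symmetric, OF int W(1)]) simp
    also have "\<dots> \<le> (\<integral>\<omega>. W \<omega> * (C1 * exp (- C2 * real k)) \<partial>M)"
    proof (rule integral_mono_AE)
      show "integrable M (\<lambda>\<omega>. W \<omega> * real_cond_exp M F (indicat_real (E k)) \<omega>)"
        by (rule F.real_cond_exp_intg(1)[OF int W(1)]) simp
      show "AE \<omega> in M. W \<omega> * real_cond_exp M F (indicat_real (E k)) \<omega> \<le> W \<omega> * (C1 * exp (- C2 * real k))"
        using tail[of k, folded E_def] by eventually_elim (intro mult_left_mono W(3))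
    qed (use W(2) in simp)
    finally show ?thesis by (simp add: I_def mult.commute)
  qed
  define q where "q = exp (- c)"
  have q: "0 < q" "q < 1" using c by (auto simp: q_def)
  have pointwise: "ennreal (W \<omega> * exp (c * Z \<omega>))
      \<le> ennreal (W \<omega>) + (\<Sum>k. ennreal (exp (c * (real k + 1)) * (W \<omega> * indicat_real (E k) \<omega>)))"
    if "\<omega> \<in> space M" for \<omega>
  proof (cases "Z \<omega> \<le> 0")
    case True
    then have "c * Z \<omega> \<le> 0" using c by (intro mult_nonneg_nonpos) auto
    then have "W \<omega> * exp (c * Z \<omega>) \<le> W \<omega>" using W(3) by (intro mult_left_le) auto
    then have "ennreal (W \<omega> * exp (c * Z \<omega>)) \<le> ennreal (W \<omega>)" by (rule ennreal_leI)
    then show ?thesis by (rule order_trans) (simp add: add_increasing2)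
  next
    case False
    define k where "k = nat (\<lceil>Z \<omega>\<rceil> - 1)"
    have "\<lceil>Z \<omega>\<rceil> \<ge> 1" using False by simp
    then have k: "real k < Z \<omega>" "Z \<omega> \<le> real k + 1" unfolding k_def by linarith+
    have "c * Z \<omega> \<le> c * (real k + 1)" using k c by (intro mult_left_mono) auto
    then have "W \<omega> * exp (c * Z \<omega>) \<le> W \<omega> * exp (c * (real k + 1))"
      using W(3) by (intro mult_left_mono) auto
    also have "\<dots> = exp (c * (real k + 1)) * (W \<omega> * indicat_real (E k) \<omega>)"
      using k that by (simp add: E_def indicator_def)
    finally have "ennreal (W \<omega> * exp (c * Z \<omega>)) \<le> ennreal (exp (c * (real k + 1)) * (W \<omega> * indicat_real (E k) \<omega>))"
      by (rule ennreal_leI)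
    also have "\<dots> \<le> (\<Sum>k. ennreal (exp (c * (real k + 1)) * (W \<omega> * indicat_real (E k) \<omega>)))"
      using sum_le_suminf[of "\<lambda>k. ennreal (exp (c * (real k + 1)) * (W \<omega> * indicat_real (E k) \<omega>))" "{k}"]
      by simp
    finally show ?thesis by (simp add: add_increasing)
  qed
  have "(\<integral>\<^sup>+\<omega>. ennreal (W \<omega> * exp (c * Z \<omega>)) \<partial>M)
      \<le> (\<integral>\<^sup>+\<omega>. ennreal (W \<omega>) + (\<Sum>k. ennreal (exp (c * (real k + 1)) * (W \<omega> * indicat_real (E k) \<omega>))) \<partial>M)"
    by (rule nn_integral_mono) (rule pointwise)
  also have "\<dots> = (\<integral>\<^sup>+\<omega>. ennreal (W \<omega>) \<partial>M)
      + (\<Sum>k. \<integral>\<^sup>+\<omega>. ennreal (exp (c * (real k + 1)) * (W \<omega> * indicat_real (E k) \<omega>)) \<partial>M)"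
    by (subst nn_integral_add) (auto simp: nn_integral_suminf)
  also have "(\<integral>\<^sup>+\<omega>. ennreal (W \<omega>) \<partial>M) = ennreal I"
    unfolding I_def by (rule nn_integral_eq_integral[OF W(2)]) (use W(3) in auto)
  also have "(\<Sum>k. \<integral>\<^sup>+\<omega>. ennreal (exp (c * (real k + 1)) * (W \<omega> * indicat_real (E k) \<omega>)) \<partial>M)
      \<le> (\<Sum>k. ennreal (C1 * exp c * I * q ^ k))"
  proof (rule suminf_le)
    fix k
    have "(\<integral>\<^sup>+\<omega>. ennreal (exp (c * (real k + 1)) * (W \<omega> * indicat_real (E k) \<omega>)) \<partial>M)
        = ennreal (\<integral>\<omega>. exp (c * (real k + 1)) * (W \<omega> * indicat_real (E k) \<omega>) \<partial>M)"
      by (rule nn_integral_eq_integral) (use int W(3) in auto)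
    also have "(\<integral>\<omega>. exp (c * (real k + 1)) * (W \<omega> * indicat_real (E k) \<omega>) \<partial>M)
        \<le> exp (c * (real k + 1)) * (C1 * exp (- C2 * real k) * I)"
      using on_tail[of k] by simp
    also have "\<dots> = C1 * exp c * I * q ^ k"
    proof -
      have "exp (c * (real k + 1)) * exp (- C2 * real k) = exp c * q ^ k"
        unfolding q_def exp_of_nat_mult[symmetric] exp_add[symmetric] by (simp add: c_def field_simps)
      then show ?thesis by (simp add: algebra_simps)
    qed
    finally show "(\<integral>\<^sup>+\<omega>. ennreal (exp (c * (real k + 1)) * (W \<omega> * indicat_real (E k) \<omega>)) \<partial>M)
        \<le> ennreal (C1 * exp c * I * q ^ k)" by (simp add: ennreal_leI)
  qed auto
  also have "(\<Sum>k. ennreal (C1 * exp c * I * q ^ k)) = ennreal (C1 * exp c * I / (1 - q))"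
  proof (rule suminf_ennreal_eq)
    show "(\<lambda>k. C1 * exp c * I * q ^ k) sums (C1 * exp c * I / (1 - q))"
      using sums_mult[OF geometric_sums[of q], of "C1 * exp c * I"] q by simp
  qed (use C I0 q in auto)
  also have "ennreal I + ennreal (C1 * exp c * I / (1 - q)) = ennreal (tail_moment C1 C2 * I)"
    using C I0 q by (simp add: ennreal_plus[symmetric] tail_moment_def c_def q_def algebra_simps del: ennreal_plus)
  finally have le: "(\<integral>\<^sup>+\<omega>. ennreal (W \<omega> * exp (c * Z \<omega>)) \<partial>M) \<le> ennreal (tail_moment C1 C2 * I)"
    by (simp add: add_left_mono)
  show int_exp: "integrable M (\<lambda>\<omega>. W \<omega> * exp (C2 / 2 * Z \<omega>))"
  proof (rule integrableI_nonneg)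
    show "(\<integral>\<^sup>+\<omega>. ennreal (W \<omega> * exp (C2 / 2 * Z \<omega>)) \<partial>M) < \<infinity>"
      using le by (simp add: c_def order_le_less_trans)
  qed (use W(3) in auto)
  have "ennreal (\<integral>\<omega>. W \<omega> * exp (C2 / 2 * Z \<omega>) \<partial>M) \<le> ennreal (tail_moment C1 C2 * I)"
    using le by (subst nn_integral_eq_integral[OF int_exp, symmetric]) (use W(3) in \<open>auto simp: c_def\<close>)
  moreover have "tail_moment C1 C2 * I \<ge> 0"
    using C I0 q by (auto simp: tail_moment_def c_def q_def intro!: mult_nonneg_nonneg add_nonneg_nonneg divide_nonneg_nonneg)
  ultimately show "(\<integral>\<omega>. W \<omega> * exp (C2 / 2 * Z \<omega>) \<partial>M) \<le> tail_moment C1 C2 * (\<integral>\<omega>. W \<omega> \<partial>M)"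
    by (simp add: I_def)
qed

text \<open>
  In the expansion \<open>exp z \<le> 1 + z + z\<^sup>2 exp \<bar>z\<bar>\<close> of \<open>exp (\<theta> D)\<close> the linear term vanishes in the mean because
  \<open>D\<close> is conditionally centred, and the quadratic term is at most a multiple of \<open>\<theta>\<^sup>2 exp (C2 / 2 * Z)\<close>.
  The bound on \<open>D\<close> is assumed only where \<open>W\<close> does not vanish, so that \<open>W\<close> can carry a stopping rule.
\<close>

lemma exp_martingale_step:
  assumes F: "subalgebra M F"
    and W: "W \<in> borel_measurable F" "integrable M W" "\<And>\<omega>. W \<omega> \<ge> 0"
    and Z [measurable]: "Z \<in> borel_measurable M" and Z0: "\<And>\<omega>. Z \<omega> \<ge> 0"
    and C: "C1 \<ge> 0" "C2 > 0"
    and tail: "\<And>k::nat. AE \<omega> in M. real_cond_exp M F (indicat_real {\<omega> \<in> space M. Z \<omega> > real k}) \<omega>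
                  \<le> C1 * exp (- C2 * real k)"
    and D [measurable]: "D \<in> borel_measurable M"
    and D_le: "\<And>\<omega>. \<omega> \<in> space M \<Longrightarrow> W \<omega> \<noteq> 0 \<Longrightarrow> \<bar>D \<omega>\<bar> \<le> r * Z \<omega>"
    and D_centered: "AE \<omega> in M. real_cond_exp M F D \<omega> = 0"
    and r: "r \<ge> 0" and \<theta>: "\<bar>\<theta>\<bar> * r \<le> C2 / 4"
  shows "integrable M (\<lambda>\<omega>. W \<omega> * exp (\<theta> * D \<omega>))"
    and "(\<integral>\<omega>. W \<omega> * exp (\<theta> * D \<omega>) \<partial>M)
           \<le> exp (\<theta>\<^sup>2 * (32 * r\<^sup>2 / C2\<^sup>2 * tail_moment C1 C2)) * (\<integral>\<omega>. W \<omega> \<partial>M)"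
proof -
  interpret F: finite_measure_subalgebra M F by unfold_locales (rule F)
  have [measurable]: "W \<in> borel_measurable M" using W(2) by auto
  define I where "I = (\<integral>\<omega>. W \<omega> \<partial>M)"
  have I0: "I \<ge> 0" unfolding I_def using W(3) by (rule Bochner_Integration.integral_nonneg)
  define Y where "Y \<omega> = exp (C2 / 2 * Z \<omega>)" for \<omega>
  have [measurable]: "Y \<in> borel_measurable M" unfolding Y_def[abs_def] by measurable
  note moment = exp_moment_if_exp_tail[OF F W Z C tail, folded Y_def I_def]
  have WD: "integrable M (\<lambda>\<omega>. W \<omega> * D \<omega>)"
  proof (rule Bochner_Integration.integrable_bound)
    show "integrable M (\<lambda>\<omega>. r * (2 / C2) * (W \<omega> * Y \<omega>))" using moment(1) by simp
    show "AE \<omega> in M. norm (W \<omega> * D \<omega>) \<le> norm (r * (2 / C2) * (W \<omega> * Y \<omega>))"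
    proof (rule AE_I2)
      fix \<omega> assume \<omega>: "\<omega> \<in> space M"
      have "C2 / 2 * Z \<omega> \<le> Y \<omega>" using exp_ge_add_one_self[of "C2 / 2 * Z \<omega>"] unfolding Y_def by linarith
      then have "Z \<omega> \<le> 2 / C2 * Y \<omega>" using C by (simp add: field_simps)
      then have "r * Z \<omega> \<le> r * (2 / C2 * Y \<omega>)" using r by (rule mult_left_mono)
      then have "W \<omega> * \<bar>D \<omega>\<bar> \<le> W \<omega> * (r * (2 / C2 * Y \<omega>))"
      proof (cases "W \<omega> = 0")
        case False
        have "\<bar>D \<omega>\<bar> \<le> r * (2 / C2 * Y \<omega>)" using D_le[OF \<omega> False] \<open>r * Z \<omega> \<le> _\<close> by linarith
        then show ?thesis using W(3) by (rule mult_left_mono)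
      qed simp
      moreover have "W \<omega> * (r * (2 / C2 * Y \<omega>)) = r * (2 / C2) * (W \<omega> * Y \<omega>)" by (simp add: mult_ac)
      ultimately show "norm (W \<omega> * D \<omega>) \<le> norm (r * (2 / C2) * (W \<omega> * Y \<omega>))"
        unfolding real_norm_def abs_mult[of "W \<omega>" "D \<omega>"] using W(3)[of \<omega>] by linarith
    qed
  qed simp
  have "(\<integral>\<omega>. W \<omega> * D \<omega> \<partial>M) = (\<integral>\<omega>. W \<omega> * real_cond_exp M F D \<omega> \<partial>M)"
    by (rule F.real_cond_exp_intg(2)[OF WD W(1), symmetric]) simp
  also have "\<dots> = (\<integral>\<omega>. 0 \<partial>M)" by (rule integral_cong_AE) (use D_centered in auto)
  finally have WD0: "(\<integral>\<omega>. W \<omega> * D \<omega> \<partial>M) = 0" by simp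
  define c where "c = 32 * r\<^sup>2 / C2\<^sup>2"
  have c: "c \<ge> 0" by (simp add: c_def)
  have pointwise: "W \<omega> * exp (\<theta> * D \<omega>) \<le> W \<omega> + \<theta> * (W \<omega> * D \<omega>) + \<theta>\<^sup>2 * c * (W \<omega> * Y \<omega>)"
    if \<omega>: "\<omega> \<in> space M" for \<omega>
  proof (cases "W \<omega> = 0")
    case False
    have D: "\<bar>D \<omega>\<bar> \<le> r * Z \<omega>" by (rule D_le[OF \<omega> False])
    have "\<bar>\<theta> * D \<omega>\<bar> \<le> \<bar>\<theta>\<bar> * (r * Z \<omega>)" unfolding abs_mult by (intro mult_left_mono D) simp
    also have "\<dots> = \<bar>\<theta>\<bar> * r * Z \<omega>" by simp
    also have "\<dots> \<le> C2 / 4 * Z \<omega>" by (intro mult_right_mono \<theta> Z0)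
    finally have 1: "exp \<bar>\<theta> * D \<omega>\<bar> \<le> exp (C2 / 4 * Z \<omega>)" by simp
    define z where "z = C2 / 4 * Z \<omega>"
    have z: "z \<ge> 0" using C Z0[of \<omega>] by (simp add: z_def)
    have "z\<^sup>2 / 2 \<le> exp z" using exp_lower_Taylor_quadratic[OF z] z by linarith
    moreover have "Z \<omega> = 4 / C2 * z" using C by (simp add: z_def)
    ultimately have Z2: "(Z \<omega>)\<^sup>2 \<le> 32 / C2\<^sup>2 * exp z"
      using C by (simp add: power_mult_distrib power_divide divide_right_mono)
    have "(\<theta> * D \<omega>)\<^sup>2 * exp \<bar>\<theta> * D \<omega>\<bar> \<le> (\<theta>\<^sup>2 * (r\<^sup>2 * (32 / C2\<^sup>2 * exp z))) * exp z"
    proof (rule mult_mono)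
      have "(D \<omega>)\<^sup>2 \<le> (r * Z \<omega>)\<^sup>2" using D by (rule abs_le_square_iff[THEN iffD1, OF order_trans]) simp
      also have "\<dots> \<le> r\<^sup>2 * (32 / C2\<^sup>2 * exp z)" unfolding power_mult_distrib by (intro mult_left_mono Z2) simp
      finally show "(\<theta> * D \<omega>)\<^sup>2 \<le> \<theta>\<^sup>2 * (r\<^sup>2 * (32 / C2\<^sup>2 * exp z))"
        unfolding power_mult_distrib by (intro mult_left_mono) auto
    qed (use 1 in \<open>auto simp: z_def\<close>)
    also have "\<dots> = \<theta>\<^sup>2 * c * Y \<omega>"
    proof -
      have "exp z * exp z = Y \<omega>" by (simp add: exp_add[symmetric] z_def Y_def)
      then show ?thesis by (simp add: c_def mult_ac)
    qed
    finally have "exp (\<theta> * D \<omega>) \<le> 1 + \<theta> * D \<omega> + \<theta>\<^sup>2 * c * Y \<omega>"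
      using exp_le_quadratic[of "\<theta> * D \<omega>"] by linarith
    then have "W \<omega> * exp (\<theta> * D \<omega>) \<le> W \<omega> * (1 + \<theta> * D \<omega> + \<theta>\<^sup>2 * c * Y \<omega>)"
      by (rule mult_left_mono) (rule W(3))
    then show ?thesis by (simp add: algebra_simps)
  qed simp
  have int_bound: "integrable M (\<lambda>\<omega>. W \<omega> + \<theta> * (W \<omega> * D \<omega>) + \<theta>\<^sup>2 * c * (W \<omega> * Y \<omega>))"
    using W(2) WD moment(1) by simp
  show int: "integrable M (\<lambda>\<omega>. W \<omega> * exp (\<theta> * D \<omega>))"
  proof (rule Bochner_Integration.integrable_bound[OF int_bound])
    show "AE \<omega> in M. norm (W \<omega> * exp (\<theta> * D \<omega>))
        \<le> norm (W \<omega> + \<theta> * (W \<omega> * D \<omega>) + \<theta>\<^sup>2 * c * (W \<omega> * Y \<omega>))"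
    proof (rule AE_I2)
      fix \<omega> assume "\<omega> \<in> space M"
      have "0 \<le> W \<omega> * exp (\<theta> * D \<omega>)" using W(3)[of \<omega>] by simp
      then show "norm (W \<omega> * exp (\<theta> * D \<omega>)) \<le> norm (W \<omega> + \<theta> * (W \<omega> * D \<omega>) + \<theta>\<^sup>2 * c * (W \<omega> * Y \<omega>))"
        using pointwise[OF \<open>\<omega> \<in> space M\<close>] unfolding real_norm_def by linarith
    qed
  qed simp
  have "(\<integral>\<omega>. W \<omega> * exp (\<theta> * D \<omega>) \<partial>M)
      \<le> (\<integral>\<omega>. W \<omega> + \<theta> * (W \<omega> * D \<omega>) + \<theta>\<^sup>2 * c * (W \<omega> * Y \<omega>) \<partial>M)"
    by (rule integral_mono[OF int int_bound pointwise])
  also have "\<dots> = I + \<theta>\<^sup>2 * c * (\<integral>\<omega>. W \<omega> * Y \<omega> \<partial>M)"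
    using W(2) WD moment(1) WD0 by (simp add: I_def)
  also have "\<dots> \<le> I + \<theta>\<^sup>2 * c * (tail_moment C1 C2 * I)"
    using moment(2) c by (intro add_left_mono mult_left_mono) auto
  also have "\<dots> = (1 + \<theta>\<^sup>2 * (c * tail_moment C1 C2)) * I" by (simp add: algebra_simps)
  also have "\<dots> \<le> exp (\<theta>\<^sup>2 * (c * tail_moment C1 C2)) * I"
    by (intro mult_right_mono I0 exp_ge_add_one_self)
  finally show "(\<integral>\<omega>. W \<omega> * exp (\<theta> * D \<omega>) \<partial>M)
      \<le> exp (\<theta>\<^sup>2 * (32 * r\<^sup>2 / C2\<^sup>2 * tail_moment C1 C2)) * (\<integral>\<omega>. W \<omega> \<partial>M)"
    by (simp add: c_def I_def)
qed

end

section \<open>Concentration of the noise within a block\<close>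

locale sa_process = sa_model a T \<gamma> h gradV V L + prob_space P
  for a :: "nat \<Rightarrow> real" and T \<gamma> :: real
    and h gradV :: "'a::euclidean_space \<Rightarrow> 'a" and V :: "'a \<Rightarrow> real" and L :: real
    and P :: "'w measure" +
  fixes x M :: "nat \<Rightarrow> 'w \<Rightarrow> 'a" and C1 C2 v0 :: real
  assumes x0_meas: "x 0 \<in> borel_measurable P"
    and iterates: "\<And>n \<omega>. \<omega> \<in> space P \<Longrightarrow>
          x (Suc n) \<omega> = x n \<omega> + a n *\<^sub>R (h (x n \<omega>) + M (Suc n) \<omega>)"
    and M_mds: "sq_int_martingale_difference P (x 0) M"
    and C1_nonneg: "C1 \<ge> 0" and C2_pos: "C2 > 0"
    and M_tail: "\<And>v i. v \<ge> v0 \<Longrightarrow> AE \<omega> in P. real_cond_exp P (sa_history P (x 0) M i)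
          (indicat_real {\<omega> \<in> space P. norm (M (Suc i) \<omega>) / (1 + norm (x i \<omega>)) > v}) \<omega>
            \<le> C1 * exp (- C2 * v)"
begin

abbreviation Filt :: "nat \<Rightarrow> 'w measure" where "Filt n \<equiv> sa_history P (x 0) M n"

abbreviation noise :: "nat \<Rightarrow> nat \<Rightarrow> 'w \<Rightarrow> 'a" where
  "noise n j \<omega> \<equiv> noise_sum a (\<lambda>m. M m \<omega>) n j"

lemma M_meas: "M (Suc n) \<in> borel_measurable P"
  using M_mds by (simp add: sq_int_martingale_difference_def)

lemma M_centered: "e \<in> Basis \<Longrightarrow> AE \<omega> in P. real_cond_exp P (Filt n) (\<lambda>\<omega>. M (Suc n) \<omega> \<bullet> e) \<omega> = 0"
  using M_mds by (simp add: sq_int_martingale_difference_def)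

lemma space_Filt: "space (Filt n) = space P"
  unfolding sa_history_def by (rule space_measure_of) auto

lemma sets_Filt: "sets (Filt n) = sigma_sets (space P)
     ({x 0 -` A \<inter> space P |A. A \<in> sets borel} \<union>
      {M k -` A \<inter> space P |k A. k \<in> {1..n} \<and> A \<in> sets borel})"
  unfolding sa_history_def by (rule sets_measure_of) auto

lemma Filt_subalgebra: "subalgebra P (Filt n)"
  unfolding subalgebra_def
proof
  show "sets (Filt n) \<subseteq> sets P"
    unfolding sets_Filt
  proof (rule sets.sigma_sets_subset, safe)
    fix A :: "'a set" assume "A \<in> sets borel"
    then show "x 0 -` A \<inter> space P \<in> sets P" by (rule measurable_sets[OF x0_meas])
  next
    fix k and A :: "'a set" assume k: "k \<in> {1..n}" "A \<in> sets borel"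
    then obtain m where "k = Suc m" by (cases k) auto
    then show "M k -` A \<inter> space P \<in> sets P" using measurable_sets[OF M_meas k(2)] by simp
  qed
qed (rule space_Filt)

lemma Filt_mono: "m \<le> n \<Longrightarrow> subalgebra (Filt n) (Filt m)"
  unfolding subalgebra_def space_Filt sets_Filt
proof (intro conjI refl sigma_sets_mono' Un_mono[OF order_refl])
  assume "m \<le> n"
  then have "{1..m} \<subseteq> {1..n}" by simp
  then show "{M k -` A \<inter> space P |k A. k \<in> {1..m} \<and> A \<in> sets borel}
      \<subseteq> {M k -` A \<inter> space P |k A. k \<in> {1..n} \<and> A \<in> sets borel}"
    by blast
qed

lemma sets_Filt_mono: "A \<in> sets (Filt m) \<Longrightarrow> m \<le> n \<Longrightarrow> A \<in> sets (Filt n)"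
  using Filt_mono by (auto simp: subalgebra_def)

lemma sets_Filt_events: "A \<in> sets (Filt n) \<Longrightarrow> A \<in> sets P"
  using Filt_subalgebra by (auto simp: subalgebra_def)

lemma M_meas_Filt: "m < n \<Longrightarrow> M (Suc m) \<in> borel_measurable (Filt n)"
proof (rule measurableI)
  fix A :: "'a set" assume "m < n" "A \<in> sets borel"
  then show "M (Suc m) -` A \<inter> space (Filt n) \<in> sets (Filt n)"
    unfolding sets_Filt space_Filt
    by (intro sigma_sets.Basic UnI2 CollectI exI[of _ "Suc m"] exI[of _ A]) auto
qed simp

lemma x_meas_Filt: "m \<le> n \<Longrightarrow> x m \<in> borel_measurable (Filt n)"
proof (induction m)
  case 0
  show ?case
  proof (rule measurableI)
    fix A :: "'a set" assume "A \<in> sets borel"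
    then show "x 0 -` A \<inter> space (Filt n) \<in> sets (Filt n)"
      unfolding sets_Filt space_Filt by (intro sigma_sets.Basic UnI1 CollectI exI[of _ A]) auto
  qed simp
next
  case (Suc m)
  have [measurable]: "x m \<in> borel_measurable (Filt n)" "M (Suc m) \<in> borel_measurable (Filt n)"
    using Suc M_meas_Filt by auto
  have [measurable]: "h \<in> borel_measurable borel"
    using lipschitz_on_continuous_on[OF h_lipschitz] by (rule borel_measurable_continuous_onI)
  have "(\<lambda>\<omega>. x m \<omega> + a m *\<^sub>R (h (x m \<omega>) + M (Suc m) \<omega>)) \<in> borel_measurable (Filt n)"
    by measurable
  then show ?case by (rule measurable_cong[THEN iffD1, rotated]) (simp add: iterates space_Filt)
qed

lemma x_meas: "x n \<in> borel_measurable P"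
  using x_meas_Filt[OF order_refl] Filt_subalgebra by (rule measurable_from_subalg[rotated])

lemma noise_meas_Filt: "j \<le> k \<Longrightarrow> noise n j \<in> borel_measurable (Filt (n + k))"
  unfolding noise_sum_def
  by (intro borel_measurable_sum borel_measurable_scaleR measurable_const M_meas_Filt) auto

lemma noise_meas: "noise n j \<in> borel_measurable P"
  using noise_meas_Filt[OF order_refl] Filt_subalgebra by (rule measurable_from_subalg[rotated])

definition C_tail :: real where "C_tail = C1 + exp (C2 * v0)"

lemma C_tail_nonneg: "C_tail \<ge> 0"
  using C1_nonneg by (simp add: C_tail_def)

text \<open>
  Below the level \<open>v0\<close> a conditional probability is at most \<open>1\<close>; enlarging the constant absorbs it.
\<close>

lemma M_tail_everywhere:
  "AE \<omega> in P. real_cond_exp P (Filt i)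
      (indicat_real {\<omega> \<in> space P. norm (M (Suc i) \<omega>) / (1 + norm (x i \<omega>)) > v}) \<omega>
    \<le> C_tail * exp (- C2 * v)"
proof (cases "v \<ge> v0")
  case True
  have le: "C1 * exp (- C2 * v) \<le> C_tail * exp (- C2 * v)"
    by (intro mult_right_mono) (auto simp: C_tail_def)
  from M_tail[OF True, of i] show ?thesis
    by eventually_elim (rule order_trans[OF _ le])
next
  case False
  interpret F: finite_measure_subalgebra P "Filt i" by unfold_locales (rule Filt_subalgebra)
  let ?E = "{\<omega> \<in> space P. norm (M (Suc i) \<omega>) / (1 + norm (x i \<omega>)) > v}"
  have "?E \<in> sets P" using M_meas[of i] x_meas[of i] by measurable
  then have "integrable P (indicat_real ?E)"
    by (intro integrable_real_indicator) (simp_all add: less_top[symmetric])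
  then have le1: "AE \<omega> in P. real_cond_exp P (Filt i) (indicat_real ?E) \<omega> \<le> 1"
    by (rule F.real_cond_exp_le_c) (auto simp: indicator_def)
  have le2: "1 \<le> C_tail * exp (- C2 * v)"
  proof -
    have "1 \<le> exp (C2 * v0) * exp (- C2 * v)"
      using False C2_pos by (simp add: exp_add[symmetric])
    also have "\<dots> \<le> C_tail * exp (- C2 * v)"
      using C1_nonneg by (intro mult_right_mono) (auto simp: C_tail_def)
    finally show ?thesis .
  qed
  from le1 show ?thesis by eventually_elim (rule order_trans[OF _ le2])
qed

text \<open>
  The noise sum is stopped as soon as its norm exceeds \<open>\<delta>\<close>. Until then the iterates stay in a fixed
  ball, so the tail bound on \<open>\<parallel>M\<parallel> / (1 + \<parallel>x\<parallel>)\<close> is an absolute one, and for each coordinate and sign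
  the exponential of \<open>\<mu>\<close> times the stopped sum grows per step by a factor \<open>exp (q \<mu>\<^sup>2 a\<^sup>2)\<close> in the mean.
  With \<open>\<mu> = \<epsilon> / a (idx n0 i)\<close> the total growth over the block is \<open>exp (O(\<epsilon>\<^sup>2) / a (idx n0 i))\<close>, as the
  squared steps add up to \<open>O(a (idx n0 i))\<close>, while Markov's inequality gains
  \<open>exp (- \<epsilon> \<delta> / (d a (idx n0 i)))\<close>; a small \<open>\<epsilon>\<close> lets the gain win. Stopping also turns the maximum over
  the block into the final value, and the event \<open>A\<close> from the past stands for the conditioning.
\<close>

lemma block_concentration:
  assumes \<delta>: "\<delta> > 0" and R0: "R0 \<ge> 0"
  shows "\<exists>\<kappa>>0. \<forall>n0 i A. A \<in> sets (Filt (idx n0 i)) \<longrightarrow> (\<forall>\<omega>\<in>A. norm (x (idx n0 i) \<omega>) \<le> R0) \<longrightarrow>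
           prob {\<omega> \<in> A. \<exists>j\<le>idx n0 (Suc i) - idx n0 i. norm (noise (idx n0 i) j \<omega>) > \<delta>}
             \<le> 2 * real DIM('a) * exp (- \<kappa> / a (idx n0 i)) * prob A"
proof -
  define d where "d = real DIM('a)"
  have d: "d > 0" by (simp add: d_def)
  define r where "r = 1 + path_radius R0 \<delta>"
  have r: "r > 0" using \<delta> R0 horizon_pos by (auto simp: r_def path_radius_def intro!: add_pos_nonneg)
  define q where "q = 32 * r\<^sup>2 / C2\<^sup>2 * tail_moment C_tail C2"
  have "exp (- (C2 / 2)) < 1" using C2_pos by simp
  then have "tail_moment C_tail C2 > 0"
    using C_tail_nonneg unfolding tail_moment_def by (intro add_pos_nonneg) auto
  then have q: "q > 0" using r C2_pos by (simp add: q_def)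
  \<comment> \<open>small enough for the exponential moment to exist and for the gain to beat the quadratic loss\<close>
  define \<epsilon> where "\<epsilon> = min (C2 / (4 * r * \<gamma>)) (\<delta> / (2 * d * q * \<gamma> * horizon))"
  have \<epsilon>: "\<epsilon> > 0" using C2_pos r \<gamma>_pos \<delta> d q horizon_pos by (simp add: \<epsilon>_def)
  have \<epsilon>_moment: "\<epsilon> * \<gamma> * r \<le> C2 / 4"
  proof -
    have "\<epsilon> \<le> C2 / (4 * r * \<gamma>)" by (simp add: \<epsilon>_def)
    moreover have "4 * r * \<gamma> > 0" using r \<gamma>_pos by simp
    ultimately have "\<epsilon> * (4 * r * \<gamma>) \<le> C2" by (simp only: pos_le_divide_eq)
    then show ?thesis by (simp add: mult_ac)
  qed
  have \<epsilon>_gain: "q * \<epsilon> * \<gamma> * horizon \<le> \<delta> / (2 * d)"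
  proof -
    have "\<epsilon> \<le> \<delta> / (2 * d * q * \<gamma> * horizon)" by (simp add: \<epsilon>_def)
    moreover have "2 * d * q * \<gamma> * horizon > 0" using d q \<gamma>_pos horizon_pos by simp
    ultimately have "\<epsilon> * (2 * d * q * \<gamma> * horizon) \<le> \<delta>" by (simp only: pos_le_divide_eq)
    then show ?thesis using d by (simp add: pos_le_divide_eq mult_ac)
  qed
  define \<kappa> where "\<kappa> = \<epsilon> * \<delta> / (2 * d)"
  have \<kappa>: "\<kappa> > 0" using \<epsilon> \<delta> d by (simp add: \<kappa>_def)
  show ?thesis
  proof (intro exI[of _ \<kappa>] conjI \<kappa> allI impI)
    fix n0 i A
    assume A: "A \<in> sets (Filt (idx n0 i))" and x_A: "\<forall>\<omega>\<in>A. norm (x (idx n0 i) \<omega>) \<le> R0"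
    define n where "n = idx n0 i"
    define N where "N = idx n0 (Suc i) - n"
    define \<alpha> where "\<alpha> = a n"
    have \<alpha>: "\<alpha> > 0" by (simp add: \<alpha>_def a_pos)
    define \<mu> where "\<mu> = \<epsilon> / \<alpha>"
    have \<mu>: "\<mu> > 0" using \<epsilon> \<alpha> by (simp add: \<mu>_def)
    have A_sp: "A \<subseteq> space P" using sets.sets_into_space[OF A] by (simp add: space_Filt)
    have A_P: "A \<in> sets P" using A by (rule sets_Filt_events)
    have step_le: "a (n + k) \<le> \<gamma> * \<alpha>" if "k < N" for k
      using block_step_le(1)[of n0 i k] that by (simp add: n_def N_def \<alpha>_def)

    \<comment> \<open>the noise has not yet left the ball of radius \<open>\<delta>\<close>: the increment of step \<open>k\<close> is still added\<close>
    define G where "G k = {\<omega> \<in> A. \<forall>j\<le>k. norm (noise n j \<omega>) \<le> \<delta>}" for k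
    have G_Filt: "G k \<in> sets (Filt (n + k))" for k
    proof -
      have "{\<omega> \<in> space (Filt (n + k)). \<forall>j\<in>{..k}. norm (noise n j \<omega>) \<le> \<delta>} \<in> sets (Filt (n + k))"
      proof (rule sets.sets_Collect_finite_All)
        fix j assume "j \<in> {..k}"
        then have [measurable]: "noise n j \<in> borel_measurable (Filt (n + k))" by (intro noise_meas_Filt) simp
        show "{\<omega> \<in> space (Filt (n + k)). norm (noise n j \<omega>) \<le> \<delta>} \<in> sets (Filt (n + k))"
          by measurable
      qed simp
      moreover have "A \<in> sets (Filt (n + k))" using A by (rule sets_Filt_mono) (simp add: n_def)
      moreover have "G k = A \<inter> {\<omega> \<in> space (Filt (n + k)). \<forall>j\<in>{..k}. norm (noise n j \<omega>) \<le> \<delta>}"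
        using A_sp unfolding G_def space_Filt by auto
      ultimately show ?thesis by auto
    qed
    have x_G: "norm (x (n + k) \<omega>) \<le> path_radius R0 \<delta>" if "\<omega> \<in> G k" "k \<le> N" for k \<omega>
    proof -
      have "\<omega> \<in> A" "\<omega> \<in> space P" using that A_sp by (auto simp: G_def)
      then show ?thesis
        using that x_A unfolding n_def
        by (intro path_bounded_in_block[where x = "\<lambda>n. x n \<omega>" and M = "\<lambda>m. M m \<omega>"] iterates)
          (use idx_less_Suc[of n0 i] in \<open>auto simp: G_def N_def n_def\<close>)
    qed
    \<comment> \<open>the stopped noise sum\<close>
    define U where "U k \<omega> = (\<Sum>m<k. (indicat_real (G m) \<omega> * a (n + m)) *\<^sub>R M (Suc (n + m)) \<omega>)" for k \<omega>
    have U_meas: "U k \<in> borel_measurable (Filt (n + k))" for k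
      unfolding U_def[abs_def]
    proof (intro borel_measurable_sum borel_measurable_scaleR borel_measurable_times borel_measurable_const)
      fix m assume "m \<in> {..<k}"
      then have "m < k" by simp
      then have "G m \<in> sets (Filt (n + k))" using sets_Filt_mono[OF G_Filt] by simp
      then show "indicat_real (G m) \<in> borel_measurable (Filt (n + k))" by (rule borel_measurable_indicator)
      show "M (Suc (n + m)) \<in> borel_measurable (Filt (n + k))" using \<open>m < k\<close> by (intro M_meas_Filt) simp
    qed
    have U_exit: "norm (U N \<omega>) > \<delta>" if \<omega>: "\<omega> \<in> A" and exits: "\<exists>j\<le>N. norm (noise n j \<omega>) > \<delta>" for \<omega>
    proof -
      define j0 where "j0 = (LEAST j. norm (noise n j \<omega>) > \<delta>)"
      obtain j where j: "j \<le> N" "norm (noise n j \<omega>) > \<delta>" using exits by blast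
      have big: "norm (noise n j0 \<omega>) > \<delta>" unfolding j0_def by (rule LeastI) (rule j(2))
      have "j0 \<le> N" unfolding j0_def using Least_le[of "\<lambda>j. norm (noise n j \<omega>) > \<delta>", OF j(2)] j(1) by simp
      have small: "norm (noise n j \<omega>) \<le> \<delta>" if "j < j0" for j
        using not_less_Least[of j "\<lambda>j. norm (noise n j \<omega>) > \<delta>"] that by (simp add: j0_def)
      have "indicat_real (G m) \<omega> = (if m < j0 then 1 else 0)" for m
        using small big \<omega> by (auto simp: G_def indicator_def) (meson not_le)
      then have "U N \<omega> = (\<Sum>m<N. if m < j0 then a (n + m) *\<^sub>R M (Suc (n + m)) \<omega> else 0)"
        unfolding U_def by (intro sum.cong) auto
      also have "\<dots> = (\<Sum>m<j0. a (n + m) *\<^sub>R M (Suc (n + m)) \<omega>)"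
        using \<open>j0 \<le> N\<close> by (intro sum.mono_neutral_cong_right) auto
      finally show ?thesis using big by (simp add: noise_sum_def)
    qed

    define W where "W \<sigma> e k \<omega> = indicat_real A \<omega> * exp (\<sigma> * \<mu> * (U k \<omega> \<bullet> e))" for \<sigma> e k \<omega>
    have W_bound: "integrable P (W \<sigma> e k) \<and>
        expectation (W \<sigma> e k) \<le> exp (q * \<mu>\<^sup>2 * (\<Sum>m<k. (a (n + m))\<^sup>2)) * prob A"
      if e: "e \<in> Basis" and \<sigma>: "\<sigma> = 1 \<or> \<sigma> = -1" and "k \<le> N" for \<sigma> e k
      using \<open>k \<le> N\<close>
    proof (induction k)
      case 0
      have "W \<sigma> e 0 = indicat_real A" by (auto simp: W_def U_def)
      moreover have "integrable P (indicat_real A)"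
        by (intro integrable_real_indicator A_P) (simp add: less_top[symmetric])
      ultimately show ?case using A_P by simp
    next
      case (Suc k)
      then have k: "k < N" and IH: "integrable P (W \<sigma> e k)"
        "expectation (W \<sigma> e k) \<le> exp (q * \<mu>\<^sup>2 * (\<Sum>m<k. (a (n + m))\<^sup>2)) * prob A" by auto
      define \<theta> where "\<theta> = \<sigma> * \<mu> * a (n + k)"
      have \<theta>2: "\<theta>\<^sup>2 = \<mu>\<^sup>2 * (a (n + k))\<^sup>2" using \<sigma> by (auto simp: \<theta>_def power_mult_distrib)
      have \<theta>r: "\<bar>\<theta>\<bar> * r \<le> C2 / 4"
      proof -
        have "\<bar>\<theta>\<bar> = \<mu> * a (n + k)" using \<sigma> \<mu> a_nonneg by (auto simp: \<theta>_def abs_mult)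
        also have "\<dots> \<le> \<mu> * (\<gamma> * \<alpha>)" using \<mu> step_le[OF k] by (intro mult_left_mono) auto
        also have "\<dots> = \<epsilon> * \<gamma>" using \<alpha> by (simp add: \<mu>_def)
        finally have "\<bar>\<theta>\<bar> * r \<le> \<epsilon> * \<gamma> * r" using r by (intro mult_right_mono) auto
        then show ?thesis using \<epsilon>_moment by linarith
      qed
      define D where "D \<omega> = M (Suc (n + k)) \<omega> \<bullet> e" for \<omega>
      define Z where "Z \<omega> = norm (M (Suc (n + k)) \<omega>) / (1 + norm (x (n + k) \<omega>))" for \<omega>
      define g where "g \<omega> = indicat_real (G k) \<omega>" for \<omega>
      define W' where "W' \<omega> = g \<omega> * W \<sigma> e k \<omega>" for \<omega>
      have GP: "G k \<in> sets P" using G_Filt by (rule sets_Filt_events)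
      have W_Filt: "W \<sigma> e k \<in> borel_measurable (Filt (n + k))"
        unfolding W_def[abs_def]
      proof (intro borel_measurable_times borel_measurable_indicator)
        show "A \<in> sets (Filt (n + k))" using A by (rule sets_Filt_mono) (simp add: n_def)
        show "(\<lambda>\<omega>. exp (\<sigma> * \<mu> * (U k \<omega> \<bullet> e))) \<in> borel_measurable (Filt (n + k))"
          using U_meas by measurable
      qed
      have W'_Filt: "W' \<in> borel_measurable (Filt (n + k))"
        unfolding W'_def[abs_def] g_def[abs_def]
        by (intro borel_measurable_times borel_measurable_indicator G_Filt W_Filt)
      have W'_int: "integrable P W'"
        unfolding W'_def[abs_def] g_def using integrable_mult_indicator[OF GP IH(1)] by simp
      have W0: "W \<sigma> e k \<omega> \<ge> 0" for \<omega> by (simp add: W_def)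
      have W'0: "W' \<omega> \<ge> 0" for \<omega> using W0 by (simp add: W'_def g_def)
      have Z_meas: "Z \<in> borel_measurable P"
        unfolding Z_def[abs_def] using M_meas[of "n + k"] x_meas[of "n + k"] by measurable
      have D_meas: "D \<in> borel_measurable P"
        unfolding D_def[abs_def] by (intro borel_measurable_inner M_meas borel_measurable_const)
      have D_le: "\<bar>D \<omega>\<bar> \<le> r * Z \<omega>" if "W' \<omega> \<noteq> 0" for \<omega>
      proof -
        have "\<omega> \<in> G k" using that by (auto simp: W'_def g_def indicator_def split: if_splits)
        then have "1 + norm (x (n + k) \<omega>) \<le> r" using x_G k by (simp add: r_def)
        have pos: "1 + norm (x (n + k) \<omega>) > 0" using norm_ge_zero[of "x (n + k) \<omega>"] by linarith
        have "\<bar>D \<omega>\<bar> \<le> norm (M (Suc (n + k)) \<omega>)" unfolding D_def by (rule Basis_le_norm[OF e])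
        also have "\<dots> = (1 + norm (x (n + k) \<omega>)) * Z \<omega>" using pos by (simp add: Z_def)
        also have "\<dots> \<le> r * Z \<omega>" using \<open>_ \<le> r\<close> pos by (intro mult_right_mono) (auto simp: Z_def)
        finally show ?thesis .
      qed
      have M_tail': "AE \<omega> in P. real_cond_exp P (Filt (n + k)) (indicat_real {\<omega> \<in> space P. Z \<omega> > real l}) \<omega>
            \<le> C_tail * exp (- C2 * real l)" for l :: nat
        using M_tail_everywhere[where v = "real l" and i = "n + k"] unfolding Z_def .
      note mgf = exp_martingale_step[OF Filt_subalgebra W'_Filt W'_int W'0 Z_meas _ C_tail_nonneg C2_pos M_tail' D_meas D_le
          _ _ \<theta>r]
      have Z0: "Z \<omega> \<ge> 0" for \<omega> by (simp add: Z_def add_nonneg_nonneg)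
      have cent: "AE \<omega> in P. real_cond_exp P (Filt (n + k)) D \<omega> = 0"
        using M_centered[OF e, of "n + k"] unfolding D_def[abs_def] .
      have mgf1: "integrable P (\<lambda>\<omega>. W' \<omega> * exp (\<theta> * D \<omega>))"
        and mgf2: "expectation (\<lambda>\<omega>. W' \<omega> * exp (\<theta> * D \<omega>)) \<le> exp (\<theta>\<^sup>2 * q) * expectation W'"
        using mgf[OF Z0 _ cent] r unfolding q_def by auto
      have W_Suc: "W \<sigma> e (Suc k) = (\<lambda>\<omega>. (1 - g \<omega>) * W \<sigma> e k \<omega> + W' \<omega> * exp (\<theta> * D \<omega>))"
      proof
        fix \<omega>
        have "U (Suc k) \<omega> \<bullet> e = U k \<omega> \<bullet> e + g \<omega> * a (n + k) * D \<omega>"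
          by (simp add: U_def g_def D_def inner_add_left)
        then have "W \<sigma> e (Suc k) \<omega> = W \<sigma> e k \<omega> * exp (g \<omega> * (\<theta> * D \<omega>))"
          by (simp add: W_def \<theta>_def exp_add[symmetric] algebra_simps)
        then show "W \<sigma> e (Suc k) \<omega> = (1 - g \<omega>) * W \<sigma> e k \<omega> + W' \<omega> * exp (\<theta> * D \<omega>)"
          by (cases "\<omega> \<in> G k") (auto simp: g_def W'_def)
      qed
      have int1: "integrable P (\<lambda>\<omega>. (1 - g \<omega>) * W \<sigma> e k \<omega>)"
      proof -
        have "(\<lambda>\<omega>. (1 - g \<omega>) * W \<sigma> e k \<omega>) = (\<lambda>\<omega>. W \<sigma> e k \<omega> - W' \<omega>)"
          by (auto simp: W'_def algebra_simps)
        then show ?thesis using IH(1) W'_int by simp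
      qed
      have int: "integrable P (W \<sigma> e (Suc k))" unfolding W_Suc using int1 mgf1 by simp
      have one: "1 \<le> exp (\<theta>\<^sup>2 * q)" using q by simp
      have "expectation (W \<sigma> e (Suc k))
          = expectation (\<lambda>\<omega>. (1 - g \<omega>) * W \<sigma> e k \<omega>) + expectation (\<lambda>\<omega>. W' \<omega> * exp (\<theta> * D \<omega>))"
        unfolding W_Suc using int1 mgf1 by simp
      also have "\<dots> \<le> exp (\<theta>\<^sup>2 * q) * expectation (\<lambda>\<omega>. (1 - g \<omega>) * W \<sigma> e k \<omega>) + exp (\<theta>\<^sup>2 * q) * expectation W'"
      proof (intro add_mono mgf2)
        have "0 \<le> expectation (\<lambda>\<omega>. (1 - g \<omega>) * W \<sigma> e k \<omega>)"
          by (rule Bochner_Integration.integral_nonneg) (use W0 in \<open>auto simp: g_def indicator_def\<close>)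
        then show "expectation (\<lambda>\<omega>. (1 - g \<omega>) * W \<sigma> e k \<omega>) \<le> exp (\<theta>\<^sup>2 * q) * expectation (\<lambda>\<omega>. (1 - g \<omega>) * W \<sigma> e k \<omega>)"
          using mult_right_mono[OF one] by fastforce
      qed
      also have "\<dots> = exp (\<theta>\<^sup>2 * q) * expectation (W \<sigma> e k)"
      proof -
        have "expectation (W \<sigma> e k) = expectation (\<lambda>\<omega>. (1 - g \<omega>) * W \<sigma> e k \<omega> + W' \<omega>)"
          by (rule Bochner_Integration.integral_cong) (auto simp: W'_def algebra_simps)
        then show ?thesis using int1 W'_int by (simp add: distrib_left)
      qed
      also have "\<dots> \<le> exp (\<theta>\<^sup>2 * q) * (exp (q * \<mu>\<^sup>2 * (\<Sum>m<k. (a (n + m))\<^sup>2)) * prob A)"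
        by (intro mult_left_mono IH(2)) simp
      also have "\<dots> = exp (q * \<mu>\<^sup>2 * (\<Sum>m<Suc k. (a (n + m))\<^sup>2)) * prob A"
        by (simp add: \<theta>2 exp_add[symmetric] algebra_simps)
      finally show ?case using int by blast
    qed

    define Bad where "Bad = {\<omega> \<in> A. \<exists>j\<le>N. norm (noise n j \<omega>) > \<delta>}"
    have Bad_P: "Bad \<in> sets P"
    proof -
      have "Bad = A - G N" by (auto simp: Bad_def G_def not_le)
      then show ?thesis using A_P sets_Filt_events[OF G_Filt] by auto
    qed
    define I where "I = (Basis :: 'a set) \<times> {1, - 1 :: real}"
    have I: "finite I" "real (card I) = 2 * d" by (auto simp: I_def d_def card_cartesian_product)
    have markov: "indicat_real Bad \<omega> * exp (\<mu> * \<delta> / d) \<le> (\<Sum>(e, \<sigma>)\<in>I. W \<sigma> e N \<omega>)" for \<omega>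
    proof (cases "\<omega> \<in> Bad")
      case True
      then have \<omega>: "\<omega> \<in> A" by (simp add: Bad_def)
      have "\<exists>e\<in>Basis. \<bar>U N \<omega> \<bullet> e\<bar> > \<delta> / d"
      proof (rule ccontr)
        assume "\<not> ?thesis"
        then have "(\<Sum>e\<in>Basis. \<bar>U N \<omega> \<bullet> e\<bar>) \<le> of_nat DIM('a) * (\<delta> / d)"
          by (intro sum_bounded_above) (auto simp: not_less)
        then have "norm (U N \<omega>) \<le> \<delta>"
          using norm_le_l1[of "U N \<omega>"] d by (simp add: d_def)
        then show False using U_exit[OF \<omega>] True by (auto simp: Bad_def)
      qed
      then obtain e where e: "e \<in> Basis" "\<bar>U N \<omega> \<bullet> e\<bar> > \<delta> / d" by blast
      define \<sigma> :: real where "\<sigma> = (if U N \<omega> \<bullet> e \<ge> 0 then 1 else -1)"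
      have "\<mu> * (\<delta> / d) \<le> \<mu> * (\<sigma> * (U N \<omega> \<bullet> e))"
        using e(2) \<mu> by (intro mult_left_mono) (auto simp: \<sigma>_def)
      then have "exp (\<mu> * \<delta> / d) \<le> W \<sigma> e N \<omega>" using \<omega> by (simp add: W_def mult_ac)
      also have "\<dots> = (case (e, \<sigma>) of (e, \<sigma>) \<Rightarrow> W \<sigma> e N \<omega>)" by simp
      also have "\<dots> \<le> (\<Sum>(e, \<sigma>)\<in>I. W \<sigma> e N \<omega>)"
        by (rule member_le_sum) (use e I in \<open>auto simp: I_def \<sigma>_def W_def\<close>)
      finally show ?thesis using True by simp
    qed (auto intro!: sum_nonneg simp: W_def)
    have sq: "(\<Sum>m<N. (a (n + m))\<^sup>2) \<le> \<gamma> * \<alpha> * horizon"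
    proof -
      have "(\<Sum>m<N. (a (n + m))\<^sup>2) \<le> (\<Sum>m<N. \<gamma> * \<alpha> * a (n + m))"
        unfolding power2_eq_square by (intro sum_mono mult_right_mono step_le a_nonneg) simp
      also have "\<dots> = \<gamma> * \<alpha> * (\<Sum>m<N. a (n + m))" by (simp add: sum_distrib_left)
      also have "\<dots> \<le> \<gamma> * \<alpha> * horizon"
        unfolding n_def using idx_less_Suc[of n0 i] \<gamma>_pos \<alpha>
        by (intro mult_left_mono block_time_le) (auto simp: N_def n_def)
      finally show ?thesis .
    qed
    have "prob Bad * exp (\<mu> * \<delta> / d) = expectation (\<lambda>\<omega>. indicat_real Bad \<omega> * exp (\<mu> * \<delta> / d))"
      using Bad_P by simp
    also have "\<dots> \<le> expectation (\<lambda>\<omega>. \<Sum>(e, \<sigma>)\<in>I. W \<sigma> e N \<omega>)"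
    proof (rule integral_mono[OF _ _ markov])
      show "integrable P (\<lambda>\<omega>. \<Sum>(e, \<sigma>)\<in>I. W \<sigma> e N \<omega>)"
        using W_bound by (intro Bochner_Integration.integrable_sum) (auto simp: I_def)
      show "integrable P (\<lambda>\<omega>. indicat_real Bad \<omega> * exp (\<mu> * \<delta> / d))"
        by (intro integrable_mult_left impI integrable_real_indicator Bad_P) (simp add: less_top[symmetric])
    qed
    also have "\<dots> = (\<Sum>(e, \<sigma>)\<in>I. expectation (W \<sigma> e N))"
      using W_bound by (subst Bochner_Integration.integral_sum) (auto simp: I_def case_prod_beta)
    also have "\<dots> \<le> (\<Sum>(e, \<sigma>)\<in>I. exp (q * \<mu>\<^sup>2 * (\<gamma> * \<alpha> * horizon)) * prob A)"
    proof (rule sum_mono, clarify)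
      fix e \<sigma> assume "(e, \<sigma>) \<in> I"
      then have "expectation (W \<sigma> e N) \<le> exp (q * \<mu>\<^sup>2 * (\<Sum>m<N. (a (n + m))\<^sup>2)) * prob A"
        using W_bound[of e \<sigma> N] by (auto simp: I_def)
      also have "\<dots> \<le> exp (q * \<mu>\<^sup>2 * (\<gamma> * \<alpha> * horizon)) * prob A"
        using sq q by (intro mult_right_mono) (auto intro!: mult_left_mono)
      finally show "expectation (W \<sigma> e N) \<le> exp (q * \<mu>\<^sup>2 * (\<gamma> * \<alpha> * horizon)) * prob A" .
    qed
    also have "\<dots> = 2 * d * exp (q * \<mu>\<^sup>2 * (\<gamma> * \<alpha> * horizon)) * prob A"
      using I(2) by (simp add: case_prod_beta)
    also have "q * \<mu>\<^sup>2 * (\<gamma> * \<alpha> * horizon) = q * \<epsilon> * \<gamma> * horizon * \<mu>"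
      using \<alpha> by (simp add: \<mu>_def power2_eq_square)
    also have "2 * d * exp (q * \<epsilon> * \<gamma> * horizon * \<mu>) * prob A \<le> 2 * d * exp (\<delta> / (2 * d) * \<mu>) * prob A"
      using mult_right_mono[OF \<epsilon>_gain, of \<mu>] \<mu> d by (intro mult_right_mono mult_left_mono) auto
    finally have "prob Bad * exp (\<mu> * \<delta> / d) * exp (- (\<mu> * \<delta> / d))
        \<le> 2 * d * exp (\<delta> / (2 * d) * \<mu>) * prob A * exp (- (\<mu> * \<delta> / d))"
      by (rule mult_right_mono) simp
    then have "prob Bad \<le> 2 * d * (exp (\<delta> / (2 * d) * \<mu>) * exp (- (\<mu> * \<delta> / d))) * prob A"
      by (simp add: exp_minus field_simps)
    also have "exp (\<delta> / (2 * d) * \<mu>) * exp (- (\<mu> * \<delta> / d)) = exp (- \<kappa> / \<alpha>)"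
      using d \<alpha> by (simp add: exp_add[symmetric] \<kappa>_def \<mu>_def field_simps)
    finally show "prob {\<omega> \<in> A. \<exists>j\<le>idx n0 (Suc i) - idx n0 i. norm (noise (idx n0 i) j \<omega>) > \<delta>}
             \<le> 2 * real DIM('a) * exp (- \<kappa> / a (idx n0 i)) * prob A"
      by (simp add: Bad_def N_def n_def \<alpha>_def d_def)
  qed
qed

end

section \<open>The probability of staying near the attractor\<close>

locale sa_restarted = sa_process a T \<gamma> h gradV V L P x M C1 C2 v0
  for a :: "nat \<Rightarrow> real" and T \<gamma> :: real
    and h gradV :: "'a::euclidean_space \<Rightarrow> 'a" and V :: "'a \<Rightarrow> real" and L :: real
    and P :: "'w measure" and x M :: "nat \<Rightarrow> 'w \<Rightarrow> 'a" and C1 C2 v0 :: real +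
  fixes B :: "'a set" and \<delta>B :: real and sol :: "nat \<Rightarrow> 'w \<Rightarrow> nat \<Rightarrow> real \<Rightarrow> 'a"
  assumes B_bounded: "bounded B" and B_open: "open B"
    and sol: "\<And>n0 \<omega> i. \<omega> \<in> space P \<Longrightarrow>
          ivp_solution h (sa_time a (sa_index a T n0 i)) (sa_time a (sa_index a T n0 (Suc i)))
            (x (sa_index a T n0 i) \<omega>) (sol n0 \<omega> i)"
    and \<delta>B_stay: "\<And>n0 i \<omega>. \<omega> \<in> space P \<Longrightarrow> x (sa_index a T n0 i) \<omega> \<in> B \<Longrightarrow>
          sa_rho a T n0 (\<lambda>n. x n \<omega>) (sol n0 \<omega>) i < \<delta>B \<Longrightarrow>
          x (sa_index a T n0 (Suc i)) \<omega> \<in> B"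
begin

abbreviation good :: "nat \<Rightarrow> 'w \<Rightarrow> nat \<Rightarrow> bool" where
  "good n0 \<omega> i \<equiv> sa_good a T B \<delta>B n0 (\<lambda>n. x n \<omega>) (sol n0 \<omega>) i"

definition good_event :: "nat \<Rightarrow> nat \<Rightarrow> 'w set" where
  "good_event n0 i = {\<omega> \<in> space P. good n0 \<omega> i}"

lemma good_event_0: "good_event n0 0 = {\<omega> \<in> space P. x n0 \<omega> \<in> B}"
  by (simp add: good_event_def sa_good_def)

lemma good_event_antimono: "i \<le> j \<Longrightarrow> good_event n0 j \<subseteq> good_event n0 i"
  by (auto simp: good_event_def sa_good_def)

lemma good_event_Filt: "good_event n0 i \<in> sets (Filt (idx n0 i))"
  using sa_good_measurable[of n0 i x "Filt (idx n0 i)" B "sol n0" \<delta>B] B_open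
  by (simp add: good_event_def space_Filt x_meas_Filt sol)

lemma good_event_sets: "good_event n0 i \<in> sets P"
  using good_event_Filt by (rule sets_Filt_events)

lemma good_event_in_B: "\<omega> \<in> good_event n0 i \<Longrightarrow> x (idx n0 i) \<omega> \<in> B"
proof (induction i)
  case 0
  then show ?case by (simp add: good_event_0)
next
  case (Suc i)
  have "\<omega> \<in> good_event n0 i" using Suc.prems good_event_antimono[of i "Suc i" n0] by auto
  then show ?case
    using \<delta>B_stay[of \<omega> n0 i] Suc.IH Suc.prems by (simp add: good_event_def sa_good_def)
qed

definition noisy :: "real \<Rightarrow> nat \<Rightarrow> nat \<Rightarrow> 'w set" where
  "noisy \<delta> n0 i = {\<omega> \<in> good_event n0 i. \<exists>j\<le>idx n0 (Suc i) - idx n0 i. norm (noise (idx n0 i) j \<omega>) > \<delta>}"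

lemma noisy_sets: "noisy \<delta> n0 i \<in> sets P"
proof -
  let ?N = "idx n0 (Suc i) - idx n0 i"
  have "{\<omega> \<in> space P. \<exists>j\<in>{..?N}. norm (noise (idx n0 i) j \<omega>) > \<delta>} \<in> sets P"
  proof (rule sets.sets_Collect_finite_Ex)
    fix j
    show "{\<omega> \<in> space P. norm (noise (idx n0 i) j \<omega>) > \<delta>} \<in> sets P"
      using noise_meas[of "idx n0 i" j] by measurable
  qed simp
  moreover have "noisy \<delta> n0 i = good_event n0 i \<inter> {\<omega> \<in> space P. \<exists>j\<in>{..?N}. norm (noise (idx n0 i) j \<omega>) > \<delta>}"
    using sets.sets_into_space[OF good_event_sets] by (auto simp: noisy_def)
  ultimately show ?thesis using good_event_sets by auto
qed

lemma prob_noisy_le: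
  assumes "\<delta> > 0"
  shows "\<exists>\<kappa>>0. \<forall>n0 i. prob (noisy \<delta> n0 i)
           \<le> 2 * real DIM('a) * exp (- \<kappa> / a (idx n0 i)) * prob (good_event n0 0)"
proof -
  obtain R where R: "R > 0" "\<And>y. y \<in> B \<Longrightarrow> norm y \<le> R"
    using B_bounded by (auto simp: bounded_pos)
  obtain \<kappa> where \<kappa>: "\<kappa> > 0" and conc: "\<And>n0 i A. A \<in> sets (Filt (idx n0 i)) \<Longrightarrow>
      (\<forall>\<omega>\<in>A. norm (x (idx n0 i) \<omega>) \<le> R) \<Longrightarrow>
      prob {\<omega> \<in> A. \<exists>j\<le>idx n0 (Suc i) - idx n0 i. norm (noise (idx n0 i) j \<omega>) > \<delta>}
        \<le> 2 * real DIM('a) * exp (- \<kappa> / a (idx n0 i)) * prob A"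
    using block_concentration[OF assms, of R] R(1) by auto
  show ?thesis
  proof (intro exI[of _ \<kappa>] conjI \<kappa> allI)
    fix n0 i
    have "prob (noisy \<delta> n0 i) \<le> 2 * real DIM('a) * exp (- \<kappa> / a (idx n0 i)) * prob (good_event n0 i)"
      unfolding noisy_def by (rule conc[OF good_event_Filt]) (use good_event_in_B R(2) in auto)
    also have "\<dots> \<le> 2 * real DIM('a) * exp (- \<kappa> / a (idx n0 i)) * prob (good_event n0 0)"
      by (intro mult_left_mono finite_measure_mono good_event_antimono good_event_sets) auto
    finally show "prob (noisy \<delta> n0 i)
        \<le> 2 * real DIM('a) * exp (- \<kappa> / a (idx n0 i)) * prob (good_event n0 0)" .
  qed
qed

lemma eventually_not_noisy:
  assumes "\<delta> > 0"
  shows "AE \<omega> in P. eventually (\<lambda>i. \<omega> \<notin> noisy \<delta> n0 i) sequentially"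
proof -
  obtain \<kappa> where \<kappa>: "\<kappa> > 0" and le: "\<And>i. prob (noisy \<delta> n0 i)
      \<le> 2 * real DIM('a) * exp (- \<kappa> / a (idx n0 i)) * prob (good_event n0 0)"
    using prob_noisy_le[OF assms] by blast
  have "summable (\<lambda>i. exp (- \<kappa> / a (idx n0 i)))"
    by (rule summableI_nonneg_bounded[OF _ block_exp_sum[OF \<kappa>]]) simp
  then have "summable (\<lambda>i. 2 * real DIM('a) * exp (- \<kappa> / a (idx n0 i)) * prob (good_event n0 0))"
    by (intro summable_mult2 summable_mult)
  then have "summable (\<lambda>i. prob (noisy \<delta> n0 i))"
    by (rule summable_comparison_test'[where N = 0]) (use le in simp)
  then have "AE \<omega> in P. eventually (\<lambda>i. \<omega> \<in> space P - noisy \<delta> n0 i) sequentially"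
    by (intro borel_cantelli_AE1 noisy_sets) (simp_all add: less_top[symmetric])
  then show ?thesis
    by eventually_elim (auto elim: eventually_mono)
qed

text \<open>
  For every noise level, the probabilities of noisy blocks on the good event are summable, so by
  Borel--Cantelli the noise over a block tends to zero almost surely there.
\<close>

lemma AE_good_converges:
  "AE \<omega> in P. (\<forall>i. \<omega> \<in> good_event n0 i) \<longrightarrow> (\<lambda>n. infdist (x n \<omega>) {y. V y = 0}) \<longlonglongrightarrow> 0"
proof -
  have "AE \<omega> in P. \<forall>q::nat. eventually (\<lambda>i. \<omega> \<notin> noisy (1 / real (Suc q)) n0 i) sequentially"
    unfolding AE_all_countable by (intro allI eventually_not_noisy) simp
  then show ?thesis
  proof (eventually_elim, intro impI)
    fix \<omega>
    assume quiet: "\<forall>q::nat. eventually (\<lambda>i. \<omega> \<notin> noisy (1 / real (Suc q)) n0 i) sequentially"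
      and good: "\<forall>i. \<omega> \<in> good_event n0 i"
    have \<omega>: "\<omega> \<in> space P" using good by (auto simp: good_event_def)
    obtain R where R: "\<And>y. y \<in> B \<Longrightarrow> norm y \<le> R"
      using B_bounded by (auto simp: bounded_iff)
    show "(\<lambda>n. infdist (x n \<omega>) {y. V y = 0}) \<longlonglongrightarrow> 0"
    proof (rule path_converges[where M = "\<lambda>m. M m \<omega>" and y = "sol n0 \<omega>" and R = R])
      show "norm (x (idx n0 i) \<omega>) \<le> R" for i using good_event_in_B R good by blast
      fix \<epsilon> :: real assume "\<epsilon> > 0"
      then obtain q where q: "1 / real (Suc q) < \<epsilon>" using nat_approx_posE by blast
      from quiet have "eventually (\<lambda>i. \<omega> \<notin> noisy (1 / real (Suc q)) n0 i) sequentially" by blast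
      then show "eventually (\<lambda>i. \<forall>k\<le>idx n0 (Suc i) - idx n0 i. norm (noise (idx n0 i) k \<omega>) \<le> \<epsilon>) sequentially"
      proof (rule eventually_mono, intro allI impI)
        fix i k assume "\<omega> \<notin> noisy (1 / real (Suc q)) n0 i" "k \<le> idx n0 (Suc i) - idx n0 i"
        then have "norm (noise (idx n0 i) k \<omega>) \<le> 1 / real (Suc q)"
          using good unfolding noisy_def by (metis (mono_tags, lifting) mem_Collect_eq not_le)
        then show "norm (noise (idx n0 i) k \<omega>) \<le> \<epsilon>" using q by linarith
      qed
    qed (use \<omega> in \<open>auto intro: iterates sol\<close>)
  qed
qed

text \<open>
  All losses are measured against the probability of the initial event, so they telescope, and
  continuity from above passes to the intersection.
\<close>

lemma prob_good_forever_ge: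
  assumes leave: "\<And>i. prob (good_event n0 i) - prob (good_event n0 (Suc i)) \<le> e i * prob (good_event n0 0)"
    and e: "\<And>n. (\<Sum>i<n. e i) \<le> S"
  shows "prob (\<Inter>i. good_event n0 i) \<ge> (1 - S) * prob (good_event n0 0)"
proof (rule LIMSEQ_le_const)
  show "(\<lambda>n. prob (good_event n0 n)) \<longlonglongrightarrow> prob (\<Inter>i. good_event n0 i)"
    by (rule finite_Lim_measure_decseq)
      (use good_event_sets good_event_antimono in \<open>auto simp: decseq_def\<close>)
  have tele: "prob (good_event n0 n) \<ge> (1 - (\<Sum>i<n. e i)) * prob (good_event n0 0)" for n
  proof (induction n)
    case (Suc n)
    then show ?case using leave[of n] by (simp add: algebra_simps)
  qed simp
  have "(1 - S) * prob (good_event n0 0) \<le> prob (good_event n0 n)" for n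
    using tele[of n] mult_right_mono[of "1 - S" "1 - (\<Sum>i<n. e i)" "prob (good_event n0 0)"] e[of n]
    by simp
  then show "\<exists>N. \<forall>n\<ge>N. (1 - S) * prob (good_event n0 0) \<le> prob (good_event n0 n)" by blast
qed

lemma converges_event: "{\<omega> \<in> space P. (\<lambda>n. infdist (x n \<omega>) H) \<longlonglongrightarrow> 0} \<in> sets P"
proof -
  have "(\<lambda>\<omega>. infdist (x n \<omega>) H) \<in> borel_measurable P" for n
    by (rule borel_measurable_continuous_on[OF _ x_meas]) (intro continuous_intros)
  then have "Measurable.pred P (\<lambda>\<omega>. (\<lambda>n. infdist (x n \<omega>) H) \<longlonglongrightarrow> 0)"
    by (intro measurable_limit)
  then show ?thesis by simp
qed

text \<open>
  The hypothesis is the comparison of the two conditional probabilities given the good event, whose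
  common denominator cancels.
\<close>

lemma leaving_prob_le_noisy:
  assumes bound: "prob (good_event n0 i) > 0 \<Longrightarrow>
      \<P>(\<omega> in P. sa_rho a T n0 (\<lambda>n. x n \<omega>) (sol n0 \<omega>) i \<ge> \<delta>B \<bar> good n0 \<omega> i)
      \<le> \<P>(\<omega> in P. (MAX j\<in>{..<idx n0 (Suc i) - idx n0 i}.
             norm (\<Sum>m\<le>j. a (idx n0 i + m) *\<^sub>R M (idx n0 i + m + 1) \<omega>)) > \<delta>
         \<bar> good n0 \<omega> i)"
  shows "prob (good_event n0 i) - prob (good_event n0 (Suc i)) \<le> prob (noisy \<delta> n0 i)"
proof (cases "prob (good_event n0 i) > 0")
  case True
  let ?leave = "{\<omega> \<in> space P. sa_rho a T n0 (\<lambda>n. x n \<omega>) (sol n0 \<omega>) i \<ge> \<delta>B \<and> good n0 \<omega> i}"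
  let ?N = "idx n0 (Suc i) - idx n0 i"
  let ?f = "\<lambda>j \<omega>. norm (\<Sum>m\<le>j. a (idx n0 i + m) *\<^sub>R M (idx n0 i + m + 1) \<omega>)"
  let ?max = "{\<omega> \<in> space P. (MAX j\<in>{..<?N}. ?f j \<omega>) > \<delta> \<and> good n0 \<omega> i}"
  have "prob ?leave / prob (good_event n0 i) \<le> prob ?max / prob (good_event n0 i)"
    using bound True by (simp add: cond_prob_def good_event_def)
  then have 1: "prob ?leave \<le> prob ?max" using True by (simp add: divide_le_cancel)
  have "?max \<subseteq> noisy \<delta> n0 i"
  proof
    fix \<omega> assume \<omega>: "\<omega> \<in> ?max"
    have "{..<?N} \<noteq> {}" using idx_less_Suc[of n0 i] by (simp add: lessThan_empty_iff)
    moreover have "(MAX j\<in>{..<?N}. ?f j \<omega>) > \<delta>" using \<omega> by simp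
    ultimately have "\<exists>j<?N. ?f j \<omega> > \<delta>" by (subst (asm) Max_gr_iff) auto
    then obtain j where j: "j < ?N" "?f j \<omega> > \<delta>" by blast
    have "?f j \<omega> = norm (noise (idx n0 i) (Suc j) \<omega>)"
      by (simp add: noise_sum_def lessThan_Suc_atMost)
    then show "\<omega> \<in> noisy \<delta> n0 i"
      using j \<omega> by (auto simp: noisy_def good_event_def intro!: exI[of _ "Suc j"])
  qed
  then have 2: "prob ?max \<le> prob (noisy \<delta> n0 i)" by (rule finite_measure_mono) (rule noisy_sets)
  have "good_event n0 i - good_event n0 (Suc i) = ?leave"
    by (auto simp: good_event_def sa_good_def less_Suc_eq not_less)
  then have "prob (good_event n0 i) - prob (good_event n0 (Suc i)) = prob ?leave"
    using finite_measure_Diff[OF good_event_sets good_event_sets good_event_antimono[of i "Suc i" n0]]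
    by simp
  then show ?thesis using 1 2 by linarith
next
  case False
  then have "prob (good_event n0 i) = 0" using measure_nonneg[of P "good_event n0 i"] by linarith
  then show ?thesis using measure_nonneg[of P "good_event n0 (Suc i)"] measure_nonneg[of P "noisy \<delta> n0 i"] by linarith
qed

lemma prob_converges_ge:
  assumes leave: "\<And>i. prob (good_event n0 i) - prob (good_event n0 (Suc i)) \<le> e i * prob (good_event n0 0)"
    and e: "\<And>n. (\<Sum>i<n. e i) \<le> S"
    and pos: "\<P>(\<omega> in P. x n0 \<omega> \<in> B) > 0"
  shows "\<P>(\<omega> in P. (\<lambda>n. infdist (x n \<omega>) {y. V y = 0}) \<longlonglongrightarrow> 0 \<bar> x n0 \<omega> \<in> B) \<ge> 1 - S"
proof -
  let ?conv = "\<lambda>\<omega>. (\<lambda>n. infdist (x n \<omega>) {y. V y = 0}) \<longlonglongrightarrow> 0"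
  have "{\<omega> \<in> space P. ?conv \<omega> \<and> x n0 \<omega> \<in> B} = {\<omega> \<in> space P. ?conv \<omega>} \<inter> good_event n0 0"
    by (auto simp: good_event_0)
  then have meas: "{\<omega> \<in> space P. ?conv \<omega> \<and> x n0 \<omega> \<in> B} \<in> sets P"
    using converges_event good_event_sets by auto
  have "AE \<omega> in P. \<omega> \<in> (\<Inter>i. good_event n0 i) \<longrightarrow> \<omega> \<in> {\<omega> \<in> space P. ?conv \<omega> \<and> x n0 \<omega> \<in> B}"
    using AE_good_converges[of n0]
  proof (eventually_elim, intro impI)
    fix \<omega> assume c: "(\<forall>i. \<omega> \<in> good_event n0 i) \<longrightarrow> ?conv \<omega>" and g: "\<omega> \<in> (\<Inter>i. good_event n0 i)"
    from g have "\<omega> \<in> good_event n0 0" by blast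
    then show "\<omega> \<in> {\<omega> \<in> space P. ?conv \<omega> \<and> x n0 \<omega> \<in> B}" using c g by (auto simp: good_event_0)
  qed
  then have "prob (\<Inter>i. good_event n0 i) \<le> prob {\<omega> \<in> space P. ?conv \<omega> \<and> x n0 \<omega> \<in> B}"
    using meas by (rule finite_measure_mono_AE)
  then have "(1 - S) * prob (good_event n0 0) \<le> prob {\<omega> \<in> space P. ?conv \<omega> \<and> x n0 \<omega> \<in> B}"
    using prob_good_forever_ge[OF leave e] by linarith
  then show ?thesis
    using pos by (simp add: cond_prob_def good_event_0 pos_le_divide_eq)
qed

end

theorem theorem11:
  fixes P :: "'w measure"
    and x M :: "nat \<Rightarrow> 'w \<Rightarrow> 'a::euclidean_space"
    and a :: "nat \<Rightarrow> real"
    and h gradV :: "'a \<Rightarrow> 'a"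
    and V :: "'a \<Rightarrow> real"
    and H B :: "'a set"
    and T \<delta>B K \<delta> :: real
    and sol :: "nat \<Rightarrow> 'w \<Rightarrow> nat \<Rightarrow> real \<Rightarrow> 'a"
  assumes prob: "prob_space P"
    and x0_meas: "x 0 \<in> borel_measurable P"
    and iterates: "\<And>n \<omega>. \<omega> \<in> space P \<Longrightarrow>
          x (Suc n) \<omega> = x n \<omega> + a n *\<^sub>R (h (x n \<omega>) + M (Suc n) \<omega>)"
    \<comment> \<open>Lyapunov function\<close>
    and V_nonneg: "\<And>y. V y \<ge> 0"
    and V_grad: "\<And>y. GDERIV V y :> gradV y"
    and V_coercive: "filterlim V at_top at_infinity"
    and V_decrease: "\<And>y. gradV y \<bullet> h y \<le> 0"
    and H_eq: "H = {y. gradV y \<bullet> h y = 0}"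
    and H_zero: "H = {y. V y = 0}"
    and B: "bounded B" "open B" "H \<subseteq> B"
    \<comment> \<open>(A1)\<close>
    and h_lipschitz: "\<exists>L. L-lipschitz_on UNIV h"
    \<comment> \<open>(A2)\<close>
    and a_pos: "\<And>n. a n > 0"
    and a_not_summable: "\<not> summable a"
    and a_sq_summable: "summable (\<lambda>n. (a n)\<^sup>2)"
    and a_almost_decreasing: "\<exists>c>0. \<forall>m n. m \<le> n \<longrightarrow> a n \<le> c * a m"
    \<comment> \<open>(A3)\<close>
    and M_mds: "sq_int_martingale_difference P (x 0) M"
    and M_second_moment: "\<exists>c>0. \<forall>n. AE \<omega> in P.
          real_cond_exp P (sa_history P (x 0) M n) (\<lambda>\<omega>. (norm (M (Suc n) \<omega>))\<^sup>2) \<omega>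
            \<le> c * (1 + (norm (x n \<omega>))\<^sup>2)"
    \<comment> \<open>tail bound\<close>
    and M_tail: "\<exists>C1>0. \<exists>C2>0. \<exists>v0. \<forall>v\<ge>v0. \<forall>i. AE \<omega> in P.
          real_cond_exp P (sa_history P (x 0) M i)
            (indicat_real {\<omega> \<in> space P. norm (M (Suc i) \<omega>) / (1 + norm (x i \<omega>)) > v}) \<omega>
            \<le> C1 * exp (- C2 * v)"
    \<comment> \<open>step sizes\<close>
    and T_pos: "T > 0"
    and a_ratio: "\<exists>\<gamma>>0. \<forall>n0 i m1 m2.
          sa_index a T n0 i + m1 < sa_index a T n0 (Suc i) \<longrightarrow>
          sa_index a T n0 i + m2 < sa_index a T n0 (Suc i) \<longrightarrow>
          a (sa_index a T n0 i + m1) / a (sa_index a T n0 i + m2) < \<gamma>"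
    \<comment> \<open>the restarted ODE solutions, and the constants attached to \<open>B\<close> and \<open>T\<close>\<close>
    and sol: "\<And>n0 \<omega> i. \<omega> \<in> space P \<Longrightarrow>
          ivp_solution h (sa_time a (sa_index a T n0 i)) (sa_time a (sa_index a T n0 (Suc i)))
            (x (sa_index a T n0 i) \<omega>) (sol n0 \<omega> i)"
    and \<delta>B_pos: "\<delta>B > 0"
    and \<delta>B_stay: "\<And>n0 i \<omega>. \<omega> \<in> space P \<Longrightarrow> x (sa_index a T n0 i) \<omega> \<in> B \<Longrightarrow>
          sa_rho a T n0 (\<lambda>n. x n \<omega>) (sol n0 \<omega>) i < \<delta>B \<Longrightarrow>
          x (sa_index a T n0 (Suc i)) \<omega> \<in> B"
    and K_pos: "K > 0"
    and \<delta>_eq: "\<delta> = \<delta>B / (2 * K)"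
    and K_bound: "eventually (\<lambda>n0. \<forall>i.
          \<P>(\<omega> in P. sa_good a T B \<delta>B n0 (\<lambda>n. x n \<omega>) (sol n0 \<omega>) i) > 0 \<longrightarrow>
          \<P>(\<omega> in P. sa_rho a T n0 (\<lambda>n. x n \<omega>) (sol n0 \<omega>) i \<ge> \<delta>B
             \<bar> sa_good a T B \<delta>B n0 (\<lambda>n. x n \<omega>) (sol n0 \<omega>) i)
          \<le> \<P>(\<omega> in P. (MAX j\<in>{..<sa_index a T n0 (Suc i) - sa_index a T n0 i}.
                 norm (\<Sum>m\<le>j. a (sa_index a T n0 i + m) *\<^sub>R M (sa_index a T n0 i + m + 1) \<omega>)) > \<delta>
             \<bar> sa_good a T B \<delta>B n0 (\<lambda>n. x n \<omega>) (sol n0 \<omega>) i)) sequentially"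
  shows "\<exists>c1>0. \<exists>c>0. eventually (\<lambda>n0.
          \<P>(\<omega> in P. x n0 \<omega> \<in> B) > 0 \<longrightarrow>
          \<P>(\<omega> in P. (\<lambda>n. infdist (x n \<omega>) H) \<longlonglongrightarrow> 0 \<bar> x n0 \<omega> \<in> B)
          \<ge> 1 - c1 * exp (- (c * \<delta> powr (2 / 3) / root 4 (\<Sum>m. (a (n0 + m))\<^sup>2)))) sequentially"
proof -
  obtain L where L: "L-lipschitz_on UNIV h" using h_lipschitz by blast
  obtain \<gamma> where \<gamma>: "\<gamma> > 0" "\<And>n0 i m1 m2.
      sa_index a T n0 i + m1 < sa_index a T n0 (Suc i) \<Longrightarrow>
      sa_index a T n0 i + m2 < sa_index a T n0 (Suc i) \<Longrightarrow>
      a (sa_index a T n0 i + m1) / a (sa_index a T n0 i + m2) < \<gamma>"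
    using a_ratio by blast
  obtain C1 C2 v0 where C: "C1 > 0" "C2 > 0" and tail: "\<And>v i. v \<ge> v0 \<Longrightarrow> AE \<omega> in P.
          real_cond_exp P (sa_history P (x 0) M i)
            (indicat_real {\<omega> \<in> space P. norm (M (Suc i) \<omega>) / (1 + norm (x i \<omega>)) > v}) \<omega>
            \<le> C1 * exp (- C2 * v)"
    using M_tail by blast
  have V_pos: "gradV y \<bullet> h y \<noteq> 0" if "V y \<noteq> 0" for y
    using that H_eq H_zero by auto
  interpret prob_space P by (rule prob)
  interpret sa_restarted a T \<gamma> h gradV V L P x M C1 C2 v0 B \<delta>B sol
    by unfold_locales
      (fact a_pos a_not_summable a_sq_summable T_pos \<gamma> L V_nonneg V_grad V_coercive V_decrease V_pos
        x0_meas iterates M_mds less_imp_le[OF C(1)] C(2) tail B(1,2) sol \<delta>B_stay)+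
  have \<delta>: "\<delta> > 0" using \<delta>B_pos K_pos by (simp add: \<delta>_eq)
  obtain \<kappa> where \<kappa>: "\<kappa> > 0" and noisy_le: "\<And>n0 i. prob (noisy \<delta> n0 i)
      \<le> 2 * real DIM('a) * exp (- \<kappa> / a (idx n0 i)) * prob (good_event n0 0)"
    using prob_noisy_le[OF \<delta>] by blast
  define c1 where "c1 = 2 * real DIM('a) * (2 * \<gamma> / (\<kappa> * T))"
  \<comment> \<open>\<open>\<kappa>\<close> depends on the fixed \<open>\<delta>\<close>, so the power of \<open>\<delta>\<close> in the claim can be divided out here\<close>
  define c where "c = \<kappa> * T / (2 * \<gamma>) / \<delta> powr (2 / 3)"
  have c1: "c1 > 0" using \<gamma> \<kappa> T_pos by (simp add: c1_def)
  have c: "c > 0" using \<gamma> \<kappa> T_pos \<delta> by (simp add: c_def)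
  have "eventually (\<lambda>n0. tail_sq n0 < 1) sequentially"
    by (rule order_tendstoD(2)[OF tail_sq_tendsto_0]) simp
  with K_bound have "eventually (\<lambda>n0. \<P>(\<omega> in P. x n0 \<omega> \<in> B) > 0 \<longrightarrow>
          \<P>(\<omega> in P. (\<lambda>n. infdist (x n \<omega>) H) \<longlonglongrightarrow> 0 \<bar> x n0 \<omega> \<in> B)
          \<ge> 1 - c1 * exp (- (c * \<delta> powr (2 / 3) / root 4 (\<Sum>m. (a (n0 + m))\<^sup>2)))) sequentially"
  proof (eventually_elim, intro impI)
    fix n0
    assume bound: "\<forall>i.
          \<P>(\<omega> in P. sa_good a T B \<delta>B n0 (\<lambda>n. x n \<omega>) (sol n0 \<omega>) i) > 0 \<longrightarrow>
          \<P>(\<omega> in P. sa_rho a T n0 (\<lambda>n. x n \<omega>) (sol n0 \<omega>) i \<ge> \<delta>B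
             \<bar> sa_good a T B \<delta>B n0 (\<lambda>n. x n \<omega>) (sol n0 \<omega>) i)
          \<le> \<P>(\<omega> in P. (MAX j\<in>{..<sa_index a T n0 (Suc i) - sa_index a T n0 i}.
                 norm (\<Sum>m\<le>j. a (sa_index a T n0 i + m) *\<^sub>R M (sa_index a T n0 i + m + 1) \<omega>)) > \<delta>
             \<bar> sa_good a T B \<delta>B n0 (\<lambda>n. x n \<omega>) (sol n0 \<omega>) i)"
      and small: "tail_sq n0 < 1" and pos: "\<P>(\<omega> in P. x n0 \<omega> \<in> B) > 0"
    let ?b = "tail_sq n0"
    have b: "?b > 0" by (rule tail_sq_pos)
    define e where "e i = 2 * real DIM('a) * exp (- \<kappa> / a (idx n0 i))" for i
    have leave: "prob (good_event n0 i) - prob (good_event n0 (Suc i)) \<le> e i * prob (good_event n0 0)" for i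
    proof (rule order_trans[OF leaving_prob_le_noisy])
      show "prob (noisy \<delta> n0 i) \<le> e i * prob (good_event n0 0)"
        using noisy_le[of n0 i] by (simp add: e_def)
    qed (rule bound[rule_format], simp add: good_event_def)
    have "(\<Sum>i<n. e i) \<le> c1 * ?b * exp (- (\<kappa> * T / (2 * \<gamma>)) / ?b)" for n
    proof -
      have "(\<Sum>i<n. e i) = 2 * real DIM('a) * (\<Sum>i<n. exp (- \<kappa> / a (idx n0 i)))"
        by (simp add: e_def sum_distrib_left)
      also have "\<dots> \<le> 2 * real DIM('a) * (2 * \<gamma> / (\<kappa> * T) * ?b * exp (- (\<kappa> * T / (2 * \<gamma>)) / ?b))"
        by (intro mult_left_mono block_exp_sum \<kappa>) simp
      finally show ?thesis by (simp add: c1_def mult.assoc)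
    qed
    then have main: "\<P>(\<omega> in P. (\<lambda>n. infdist (x n \<omega>) H) \<longlonglongrightarrow> 0 \<bar> x n0 \<omega> \<in> B)
        \<ge> 1 - c1 * ?b * exp (- (\<kappa> * T / (2 * \<gamma>)) / ?b)"
      unfolding H_zero by (rule prob_converges_ge[OF leave _ pos])
    \<comment> \<open>the bound obtained is of order \<open>exp (- c / b)\<close>, which is stronger than the claim when \<open>b \<le> 1\<close>\<close>
    have "?b \<le> root 4 ?b"
    proof -
      have "?b ^ 4 \<le> ?b ^ 1" using b small by (intro power_decreasing) auto
      then have "root 4 (?b ^ 4) \<le> root 4 ?b" by simp
      then show ?thesis using b by (simp add: real_root_power_cancel)
    qed
    then have "\<kappa> * T / (2 * \<gamma>) / root 4 ?b \<le> \<kappa> * T / (2 * \<gamma>) / ?b"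
      using b \<kappa> T_pos \<gamma>(1) by (intro divide_left_mono) auto
    then have "?b * exp (- (\<kappa> * T / (2 * \<gamma>)) / ?b) \<le> 1 * exp (- (\<kappa> * T / (2 * \<gamma>) / root 4 ?b))"
      using small b by (intro mult_mono) auto
    then have final: "c1 * ?b * exp (- (\<kappa> * T / (2 * \<gamma>)) / ?b) \<le> c1 * exp (- (\<kappa> * T / (2 * \<gamma>) / root 4 ?b))"
      using mult_left_mono[OF _ less_imp_le[OF c1]] by (simp add: mult.assoc)
    have exponent: "c * \<delta> powr (2 / 3) = \<kappa> * T / (2 * \<gamma>)" using \<delta> by (simp add: c_def)
    show "\<P>(\<omega> in P. (\<lambda>n. infdist (x n \<omega>) H) \<longlonglongrightarrow> 0 \<bar> x n0 \<omega> \<in> B)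
          \<ge> 1 - c1 * exp (- (c * \<delta> powr (2 / 3) / root 4 (\<Sum>m. (a (n0 + m))\<^sup>2)))"
      using main final unfolding exponent tail_sq_def[symmetric] by linarith
  qed
  then show ?thesis using c1 c by blast
qed

end
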